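(* Let $\mathcal G$ be a finite edge-weighted graph (general, not necessarily planar) with a set of distinguished vertices called nodes, and let $L$ be its response matrix. Suppose that $A$, $B$, $C$, and $D$ are pairwise disjoint sets of nodes such that $|A|=|B|$ and $A\cup B\cup C\cup D$ is the set of all nodes. Enumerate $A=\{a_1,\dots,a_{|A|}\}$, $B=\{b_1,\dots,b_{|B|}\}$, $C=\{c_1,\dots,c_{|C|}\}$, $D=\{d_1,\dots,d_{|D|}\}$. Then the determinant of $L_{(A\cup C),(B\cup C)}$ is given by $$\det\left[L_{i,j}\right]^{i=a_1,\dots,a_{|A|},c_1,\dots,c_{|C|}}_{j=b_1,\dots,b_{|B|},c_1,\dots,c_{|C|}}=\frac{\sum_\pi(-1)^\pi\,\Pr\left[a_1,b_{\pi(1)}\,|\,\cdots\,|\,a_{|A|},b_{\pi(|A|)}\,|\,d_1\,|\,\cdots\,|\,d_{|D|}\right]}{\Pr[\text{uncrossing}]},$$ where the nodes of $C$ may appear in any of the displayed parts. Here rows are indexed by $i$ and columns by $j$ in the orders shown, the sum is over all permutations $\pi$ of $\{1,\dots,|A|\}$ with sign $(-1)^\pi$, and $\Pr[\,a_1,b_{\pi(1)}|\cdots|a_{|A|},b_{\pi(|A|)}|d_1|\cdots|d_{|D|}]$ denotes the probability that the node partition induced by a random grove is obtained from the displayed partition of $A\cup B\cup D$ by inserting each node of $C$ into one of the displayed parts.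
   Context: The edge weights are positive and are regarded as conductances of a resistor network. Vertices that are not nodes are called internal. Grove: a spanning forest of $\mathcal G$ in which every component tree contains at least one node. Each grove determines a partition of the nodes (two nodes are in the same part iff they are in the same component tree). The probability of a grove is proportional to the product of the weights of its edges. $\Pr[\text{uncrossing}]$ is the probability that the partition induced by a random grove is the one in which every node is a singleton part. Response matrix $L=(L_{i,j})$, indexed by the nodes: $Lv$ is the vector of net currents out of the nodes when $v$ is a vector of potentials applied to the nodes and no current loss occurs at the internal vertices. The sign convention is that the off-diagonal entries of $L$ are non-negative: if $V$ is the extension of $v$ to all vertices that is harmonic at internal vertices, then $(Lv)_i=\sum_{w} c_{i,w}(V(w)-V(i))$, the sum being over edges from $i$ to neighbours $w$ with conductance $c_{i,w}$.
   Formalization: The right-hand side carries an extra factor (-1)^|C|, since the printed formula fails for |C| odd (one unit edge between nodes 1 and 2, C={1}, D={2}: L_11=-1 but the ratio is +1); it is also assumed that at least one grove exists, so that the probabilities are defined. *)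

theory Defs
  imports "HOL-Probability.Probability" "Jordan_Normal_Form.Determinant"
begin

text \<open>
  Networks are undirected multigraphs: an edge \<open>e\<close> has a set \<open>ends e\<close> of one or two endpoints, so
  parallel edges and loops are allowed. Simple graphs are the case where \<open>ends\<close> is injective on the
  edges and never a singleton.
\<close>

record ('v, 'e) network =
  verts :: "'v set"
  edges :: "'e set"
  ends :: "'e \<Rightarrow> 'v set"
  conductance :: "'e \<Rightarrow> real"
  nodes :: "'v set"

locale finite_network =
  fixes G :: "('v, 'e) network"
  assumes finite_verts: "finite (verts G)"
    and finite_edges: "finite (edges G)"
    and ends_edge: "e \<in> edges G \<Longrightarrow> \<exists>u\<in>verts G. \<exists>w\<in>verts G. ends G e = {u, w}"
    and conductance_pos: "e \<in> edges G \<Longrightarrow> 0 < conductance G e"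
    and nodes_subset: "nodes G \<subseteq> verts G"


subsection \<open>Response matrix\<close>

definition net_current :: "('v, 'e) network \<Rightarrow> ('v \<Rightarrow> real) \<Rightarrow> 'v \<Rightarrow> real" where
  "net_current G V u =
     (\<Sum>w\<in>verts G. \<Sum>e\<in>{e \<in> edges G. ends G e = {u, w}}. conductance G e * (V w - V u))"

definition harmonic_extension ::
    "('v, 'e) network \<Rightarrow> ('v \<Rightarrow> real) \<Rightarrow> ('v \<Rightarrow> real) \<Rightarrow> bool" where
  "harmonic_extension G v V \<longleftrightarrow>
     (\<forall>i\<in>nodes G. V i = v i) \<and> (\<forall>u\<in>verts G - nodes G. net_current G V u = 0)"

text \<open>
  The harmonic extension is unique up to an additive constant on each connected component without
  nodes (and up to its irrelevant values outside \<open>verts G\<close>), and the currents at the nodes do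
  not depend on that choice.
\<close>

definition response :: "('v, 'e) network \<Rightarrow> ('v \<Rightarrow> real) \<Rightarrow> 'v \<Rightarrow> real" where
  "response G v i = net_current G (SOME V. harmonic_extension G v V) i"

text \<open>The \<open>j\<close>-th column of \<open>L\<close> is the image under the linear map \<open>v \<mapsto> L v\<close> of the potential
  that is 1 at \<open>j\<close> and 0 at the other nodes.\<close>

definition response_matrix :: "('v, 'e) network \<Rightarrow> 'v \<Rightarrow> 'v \<Rightarrow> real" where
  "response_matrix G i j = response G (\<lambda>k. if k = j then 1 else 0) i"


subsection \<open>Groves\<close>

text \<open>\<open>connection G F\<close> is reflexive on the whole vertex type; it is only used from vertices of \<open>G\<close>.\<close>

definition connection :: "('v, 'e) network \<Rightarrow> 'e set \<Rightarrow> ('v \<times> 'v) set" where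
  "connection G F = {(u, w). \<exists>e\<in>F. ends G e = {u, w}}\<^sup>*"

text \<open>
  A cycle visits the distinct vertices \<open>vs ! 0, vs ! 1, \<dots>\<close> and returns to \<open>vs ! 0\<close>, using distinct
  edges. Length 1 is a loop and length 2 a pair of parallel edges.
\<close>

definition is_cycle :: "('v, 'e) network \<Rightarrow> 'v list \<Rightarrow> 'e list \<Rightarrow> bool" where
  "is_cycle G vs es \<longleftrightarrow>
     es \<noteq> [] \<and> length vs = length es \<and> distinct vs \<and> distinct es \<and>
     (\<forall>k<length es. ends G (es ! k) = {vs ! k, vs ! (Suc k mod length es)})"

text \<open>A spanning forest contains all vertices, so it is given by its set of edges; its component
  trees are the classes of \<open>verts G\<close> under \<open>connection G F\<close>.\<close>

definition spanning_forest :: "('v, 'e) network \<Rightarrow> 'e set \<Rightarrow> bool" where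
  "spanning_forest G F \<longleftrightarrow> F \<subseteq> edges G \<and> \<not> (\<exists>vs es. is_cycle G vs es \<and> set es \<subseteq> F)"

definition groves :: "('v, 'e) network \<Rightarrow> 'e set set" where
  "groves G = {F. spanning_forest G F \<and> (\<forall>T \<in> verts G // connection G F. T \<inter> nodes G \<noteq> {})}"

definition node_partition :: "('v, 'e) network \<Rightarrow> 'e set \<Rightarrow> 'v set set" where
  "node_partition G F = nodes G // {(u, w) \<in> connection G F. u \<in> nodes G \<and> w \<in> nodes G}"

definition grove_weight :: "('v, 'e) network \<Rightarrow> 'e set \<Rightarrow> real" where
  "grove_weight G F = (\<Prod>e\<in>F. conductance G e)"

definition random_grove :: "('v, 'e) network \<Rightarrow> 'e set pmf" where
  "random_grove G = embed_pmf
     (\<lambda>F. if F \<in> groves G then grove_weight G F / (\<Sum>F'\<in>groves G. grove_weight G F') else 0)"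

text \<open>\<open>embed_pmf\<close> is only meaningful for a function that is a probability mass function; this is so
  whenever there is a grove, i.e. whenever every vertex is connected to some node.\<close>

lemma (in finite_network) pmf_random_grove:
  assumes "groves G \<noteq> {}"
  shows "pmf (random_grove G) F =
    (if F \<in> groves G then grove_weight G F / (\<Sum>F'\<in>groves G. grove_weight G F') else 0)"
proof -
  let ?Z = "\<Sum>F'\<in>groves G. grove_weight G F'"
  let ?p = "\<lambda>F. if F \<in> groves G then grove_weight G F / ?Z else 0"
  have sub: "groves G \<subseteq> Pow (edges G)"
    by (auto simp: groves_def spanning_forest_def)
  then have fin: "finite (groves G)"
    using finite_edges by (meson finite_Pow_iff finite_subset)
  have pos: "0 < grove_weight G F" if "F \<in> groves G" for F
    using that sub conductance_pos unfolding grove_weight_def by (intro prod_pos) blast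
  then have Z: "0 < ?Z"
    using fin assms by (intro sum_pos) auto
  have nonneg: "0 \<le> ?p F" for F
    using pos Z by (auto intro!: divide_nonneg_nonneg less_imp_le)
  have "(\<integral>\<^sup>+F. ennreal (?p F) \<partial>count_space UNIV) = (\<Sum>F\<in>groves G. ennreal (?p F))"
    using fin by (intro nn_integral_count_space') auto
  also have "\<dots> = ennreal (\<Sum>F\<in>groves G. ?p F)"
    by (rule sum_ennreal) (rule nonneg)
  also have "(\<Sum>F\<in>groves G. ?p F) = 1"
    using Z by (simp add: sum_divide_distrib[symmetric])
  finally show ?thesis
    unfolding random_grove_def by (subst pmf_embed_pmf[OF nonneg]) simp_all
qed

definition Pr_partition :: "('v, 'e) network \<Rightarrow> 'v set set set \<Rightarrow> real" where
  "Pr_partition G \<P> = measure_pmf.prob (random_grove G) {F. node_partition G F \<in> \<P>}"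

definition Pr_uncrossing :: "('v, 'e) network \<Rightarrow> real" where
  "Pr_uncrossing G = Pr_partition G {{{i} | i. i \<in> nodes G}}"


subsection \<open>Partitions in the determinant formula\<close>

definition insertions :: "'v set set \<Rightarrow> 'v set \<Rightarrow> 'v set set set" where
  "insertions Q C = {{S \<union> {x \<in> C. f x = S} | S. S \<in> Q} | f. f \<in> C \<rightarrow> Q}"

definition displayed_partition ::
    "'v list \<Rightarrow> 'v list \<Rightarrow> 'v list \<Rightarrow> (nat \<Rightarrow> nat) \<Rightarrow> 'v set set" where
  "displayed_partition a b d \<pi> =
     {{a ! k, b ! \<pi> k} | k. k < length a} \<union> {{x} | x. x \<in> set d}"

text \<open>
  Since the off-diagonal entries of \<open>L\<close> are non-negative, its diagonal entries are non-positive: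
  principal minors of \<open>L\<close> on \<open>C\<close> carry the sign \<open>(-1)\<close> to the power \<open>card C\<close>, which therefore appears in
  the determinant formula.
\<close>

definition submatrix_of :: "('v \<Rightarrow> 'v \<Rightarrow> real) \<Rightarrow> 'v list \<Rightarrow> 'v list \<Rightarrow> real mat" where
  "submatrix_of L rs cs = mat (length rs) (length cs) (\<lambda>(k, l). L (rs ! k) (cs ! l))"

end

theory Submission
  imports Defs
begin

text \<open>
  Write \<open>\<Delta>\<close> for the Laplacian of the network, signed so that it maps potentials to net currents, and let
  \<open>I\<close> be the set of interior vertices. The response matrix is the Schur complement of \<open>\<Delta>\<^sub>I\<^sub>,\<^sub>I\<close> in \<open>\<Delta>\<close>, so
  each of its minors is a quotient of two minors of \<open>\<Delta>\<close> (\<open>det_response_minor\<close>):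
  the minor with rows \<open>A \<union> C\<close> and columns \<open>B \<union> C\<close> is that of \<open>\<Delta>\<close> with rows \<open>A \<union> C \<union> I\<close> and columns
  \<open>B \<union> C \<union> I\<close>, divided by \<open>det \<Delta>\<^sub>I\<^sub>,\<^sub>I\<close>. In the numerator the nodes of \<open>C\<close> play exactly the role of interior
  vertices, which is why they may lie in any part of the partition.

  Minors of \<open>\<Delta>\<close> count forests (\<open>all_minors_matrix_tree\<close>). Since \<open>-\<Delta> = X diag(c) X\<^sup>T\<close> for the signed
  incidence matrix \<open>X\<close>, Cauchy--Binet writes the minor as a sum over edge sets \<open>F\<close> of the weight of \<open>F\<close> times
  two minors of \<open>X\<close> with the columns \<open>F\<close>, one with the rows \<open>B \<union> D\<close> deleted and one with the rows
  \<open>A \<union> D\<close> deleted. Two elementary observations describe these. The rows of a component of \<open>F\<close> add up to 0,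
  so a minor vanishes if some component contains no deleted row. Otherwise paths to the deleted rows
  give an integer right inverse, so the minor is 1 or -1; being nonzero, it forces \<open>F\<close> to
  be a forest with exactly one deleted row in each component. Hence the sets \<open>F\<close> that
  contribute are those whose components contain one element of \<open>A\<close> and one of \<open>B\<close>, or one element of \<open>D\<close>;
  they define a bijection \<open>\<pi>\<close> from \<open>A\<close> to \<open>B\<close>. Using again that rows add up to 0 over a component, the rows of \<open>A\<close>
  can be exchanged for those of \<open>B\<close>, which shows that the product of the two minors is the sign of \<open>\<pi>\<close>
  up to a factor \<open>(-1)\<close> to the power \<open>card A\<close>.

  The same theorem with all nodes in the role of \<open>D\<close> evaluates \<open>det \<Delta>\<^sub>I\<^sub>,\<^sub>I\<close> as the weight of the uncrossing groves,
  and it only remains to recognise the contributing forests as the groves with the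
  displayed partitions (\<open>linking_iff_grove\<close>).
\<close>

section \<open>The Cauchy--Binet formula\<close>

lemma index_mult_mat_sum:
  assumes "A \<in> carrier_mat n k" "B \<in> carrier_mat k l" "i < n" "j < l"
  shows "(A * B) $$ (i, j) = (\<Sum>r<k. A $$ (i, r) * B $$ (r, j))"
  using assms by (auto simp: scalar_prod_def atLeast0LessThan)

text \<open>
  This is \<open>det (N + t u w\<^sup>T) = det N - t det [[N, u], [w\<^sup>T, 0]]\<close>. The matrix
  \<open>[[N, -t u], [w\<^sup>T, 1]]\<close> has determinant \<open>det (N + t u w\<^sup>T)\<close>, because clearing its last row by
  column operations leaves that matrix in the upper left block. On the other hand its determinant is an
  affine function of the last column, which gives the right-hand side.
\<close>

lemma det_rank_one_update:
  fixes N :: "real mat"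
  assumes N: "N \<in> carrier_mat m m"
  shows "Determinant.det (mat m m (\<lambda>(i, j). N $$ (i, j) + t * u i * w j)) =
    Determinant.det N - t * Determinant.det (mat (Suc m) (Suc m)
      (\<lambda>(i, j). if i < m then if j < m then N $$ (i, j) else u i else if j < m then w j else 0))"
proof -
  define B where "B z s = mat (Suc m) (Suc m)
      (\<lambda>(i, j). if i < m then if j < m then N $$ (i, j) else z * u i else if j < m then w j else s)"
    for z s :: real
  have B: "B z s \<in> carrier_mat (Suc m) (Suc m)" for z s
    by (simp add: B_def)
  \<comment> \<open>The cofactors along the last column do not see that column, so the determinant is affine in it.\<close>
  have cof: "cofactor (B z s) i m = cofactor (B 1 0) i m" if "i \<le> m" for z s i
  proof -
    have "mat_delete (B z s) i m = mat_delete (B 1 0) i m"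
      using that by (intro eq_matI) (auto simp: mat_delete_def B_def)
    then show ?thesis
      by (simp add: cofactor_def)
  qed
  have cofm: "cofactor (B 1 0) m m = Determinant.det N"
  proof -
    have "mat_delete (B 1 0) m m = N"
      using N by (intro eq_matI) (auto simp: mat_delete_def B_def)
    then show ?thesis
      by (simp add: cofactor_def flip: power_add mult_2)
  qed
  have detB: "Determinant.det (B z s) = z * (\<Sum>i<m. u i * cofactor (B 1 0) i m) + s * Determinant.det N"
    for z s
  proof -
    have "Determinant.det (B z s) = (\<Sum>i<Suc m. B z s $$ (i, m) * cofactor (B z s) i m)"
      by (rule laplace_expansion_column[OF B]) simp
    also have "\<dots> = (\<Sum>i<Suc m. B z s $$ (i, m) * cofactor (B 1 0) i m)"
      by (intro sum.cong) (simp_all add: cof[where z=z and s=s])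
    also have "\<dots> = (\<Sum>i<m. z * u i * cofactor (B 1 0) i m) + s * Determinant.det N"
      by (simp add: B_def[of z s] cofm)
    finally show ?thesis
      by (simp add: sum_distrib_left mult.assoc)
  qed
  \<comment> \<open>Multiplying by \<open>E\<close> from the right clears the last row of \<open>B (-t) 1\<close>.\<close>
  define E where "E = mat (Suc m) (Suc m) (\<lambda>(i, j). if i = j then 1 else if i = m then - w j else 0)"
  have E: "E \<in> carrier_mat (Suc m) (Suc m)"
    by (simp add: E_def)
  have "Determinant.det E = prod_list (diag_mat E)"
    by (rule det_lower_triangular[OF _ E]) (auto simp: E_def)
  also have "\<dots> = 1"
  proof -
    have "diag_mat E = replicate (Suc m) 1"
      by (auto simp: list_eq_iff_nth_eq diag_mat_def E_def simp del: upt_Suc replicate_Suc)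
    then show ?thesis
      by (simp only: prod_list_replicate power_one)
  qed
  finally have detE: "Determinant.det E = 1" .
  have BE: "(B (- t) 1 * E) $$ (i, j) =
      (if i < m then if j < m then N $$ (i, j) + t * u i * w j else - t * u i
       else if j < m then 0 else 1)"
    if "i < Suc m" "j < Suc m" for i j
  proof -
    have "(B (- t) 1 * E) $$ (i, j) = (\<Sum>k<Suc m. B (- t) 1 $$ (i, k) * E $$ (k, j))"
      by (rule index_mult_mat_sum[OF B E that])
    also have "\<dots> = (\<Sum>k<m. B (- t) 1 $$ (i, k) * (if k = j then 1 else 0)) +
        B (- t) 1 $$ (i, m) * (if j = m then 1 else - w j)"
      using that by (auto simp: E_def intro!: sum.cong)
    also have "(\<Sum>k<m. B (- t) 1 $$ (i, k) * (if k = j then 1 else 0)) =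
        (if j < m then B (- t) 1 $$ (i, j) else 0)"
      by (simp add: if_distrib cong: if_cong)
    finally show ?thesis
      using that by (auto simp: B_def)
  qed
  have BEc: "B (- t) 1 * E \<in> carrier_mat (Suc m) (Suc m)"
    by (rule mult_carrier_mat[OF B E])
  have "Determinant.det (B (- t) 1) = Determinant.det (B (- t) 1 * E)"
    by (simp add: det_mult[OF B E] detE)
  also have "\<dots> = (\<Sum>j<Suc m. (B (- t) 1 * E) $$ (m, j) * cofactor (B (- t) 1 * E) m j)"
    by (rule laplace_expansion_row[OF BEc]) simp
  also have "\<dots> = cofactor (B (- t) 1 * E) m m"
    by (simp add: BE)
  also have "\<dots> = Determinant.det (mat_delete (B (- t) 1 * E) m m)"
    by (simp add: cofactor_def flip: power_add mult_2)
  also have "mat_delete (B (- t) 1 * E) m m = mat m m (\<lambda>(i, j). N $$ (i, j) + t * u i * w j)"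
    using B[of "-t" 1] E 
    by (intro eq_matI) (auto simp: mat_delete_def BE simp del: index_mult_mat(1))
  finally show ?thesis
    using detB[of "- t" 1] detB[of 1 0] by (simp add: B_def cong: if_cong)
qed

text \<open>
  The block matrix \<open>[[\<Sum>\<^sub>e c\<^sub>e x\<^sub>e y\<^sub>e\<^sup>T, X], [Y\<^sup>T, 0]]\<close>: the sum ranges over the list \<open>es\<close> of pending
  indices, and the border has one column \<open>x\<^sub>f\<close> and one row \<open>y\<^sub>f\<close> for each index in the list \<open>fs\<close>.
  Removing an index from \<open>es\<close> is a rank one update, so the index either disappears or moves to the
  border.
\<close>

definition bordered :: "nat \<Rightarrow> ('e \<Rightarrow> real) \<Rightarrow> ('e \<Rightarrow> nat \<Rightarrow> real) \<Rightarrow> ('e \<Rightarrow> nat \<Rightarrow> real) \<Rightarrow>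
    'e list \<Rightarrow> 'e list \<Rightarrow> real mat" where
  "bordered n c x y es fs = mat (n + length fs) (n + length fs)
     (\<lambda>(i, j). if i < n then if j < n then (\<Sum>e\<leftarrow>es. c e * x e i * y e j) else x (fs ! (j - n)) i
               else if j < n then y (fs ! (i - n)) j else 0)"

lemma det_bordered_Cons:
  "Determinant.det (bordered n c x y (e # es) fs) =
    Determinant.det (bordered n c x y es fs) - c e * Determinant.det (bordered n c x y es (fs @ [e]))"
proof -
  let ?m = "n + length fs"
  define N where "N = bordered n c x y es fs"
  define u where "u i = (if i < n then x e i else 0)" for i
  define w where "w j = (if j < n then y e j else 0)" for j
  have N: "N \<in> carrier_mat ?m ?m"
    by (simp add: N_def bordered_def)
  have 1: "bordered n c x y (e # es) fs = mat ?m ?m (\<lambda>(i, j). N $$ (i, j) + c e * u i * w j)"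
    by (rule eq_matI) (auto simp: bordered_def N_def u_def w_def)
  have 2: "bordered n c x y es (fs @ [e]) = mat (Suc ?m) (Suc ?m)
      (\<lambda>(i, j). if i < ?m then if j < ?m then N $$ (i, j) else u i else if j < ?m then w j else 0)"
    by (rule eq_matI) (auto simp: bordered_def N_def u_def w_def nth_append less_Suc_eq)
  show ?thesis
    unfolding 1 2 by (subst det_rank_one_update[OF N]) (simp add: N_def)
qed

text \<open>
  Once all indices have been decided, only the border is left. If it has \<open>n\<close> rows and columns, the
  matrix is \<open>[[0, X], [Y\<^sup>T, 0]]\<close> with square blocks and its determinant is \<open>det (- X Y\<^sup>T)\<close>; otherwise
  one of the two zero blocks is too large for a nonzero term in the Leibniz expansion.
\<close>

lemma det_bordered_Nil:
  "Determinant.det (bordered n c x y [] fs) =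
    (if length fs = n then (-1) ^ n * Determinant.det (mat n n (\<lambda>(i, j). x (fs ! j) i)) *
        Determinant.det (mat n n (\<lambda>(i, j). y (fs ! j) i))
     else 0)"
proof (cases "length fs = n")
  case True
  define X where "X = mat n n (\<lambda>(i, j). x (fs ! j) i)"
  define Y where "Y = mat n n (\<lambda>(i, j). y (fs ! j) i)"
  have X: "X \<in> carrier_mat n n" and Y: "Y \<in> carrier_mat n n"
    by (simp_all add: X_def Y_def)
  have "bordered n c x y [] fs = four_block_mat (0\<^sub>m n n) X Y\<^sup>T (0\<^sub>m n n)"
    using True by (intro eq_matI) (auto simp: bordered_def X_def Y_def)
  also have "Determinant.det \<dots> = Determinant.det (0\<^sub>m n n * 0\<^sub>m n n - X * Y\<^sup>T)"
    using X Y by (intro det_four_block_mat) auto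
  also have "0\<^sub>m n n * 0\<^sub>m n n - X * Y\<^sup>T = (-1) \<cdot>\<^sub>m (X * Y\<^sup>T)"
    using X Y by (intro eq_matI) auto
  also have "Determinant.det \<dots> = (-1) ^ n * Determinant.det X * Determinant.det Y"
    using X Y by (simp add: det_mult[of _ n] det_transpose)
  finally show ?thesis
    using True by (simp add: X_def Y_def)
next
  case False
  let ?m = "n + length fs"
  let ?M = "bordered n c x y [] fs"
  \<comment> \<open>A permutation that avoids both zero blocks exchanges the first \<open>n\<close> indices with the others.\<close>
  have "(\<Prod>i = 0..<?m. ?M $$ (i, p i)) = 0" if p: "p permutes {0..<?m}" for p
  proof (rule ccontr)
    assume "\<not> ?thesis"
    then have nz: "?M $$ (i, p i) \<noteq> 0" if "i < ?m" for i
      using that by simp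
    have pm: "p i < ?m \<longleftrightarrow> i < ?m" for i
      using permutes_in_image[OF p, of i] by simp
    have "\<not> p i < n" if "i < n" for i
      using nz[of i] pm[of i] that by (auto simp: bordered_def)
    moreover have "p i < n" if "\<not> i < n" "i < ?m" for i
      using nz[of i] pm[of i] that by (auto simp: bordered_def split: if_splits)
    ultimately have sub: "p ` {..<n} \<subseteq> {n..<?m}" "p ` {n..<?m} \<subseteq> {..<n}"
      using pm by force+
    have "inj_on p S" for S
      using permutes_inj_on[OF p] .
    then have "card {..<n} \<le> card {n..<?m}" "card {n..<?m} \<le> card {..<n}"
      using sub by (meson card_inj_on_le finite_atLeastLessThan finite_lessThan)+
    with False show False
      by simp
  qed
  then show ?thesis
    using False by (subst det_def'[of _ ?m]) (auto simp: bordered_def intro!: sum.neutral)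
qed

lemma det_bordered:
  assumes "distinct es"
  shows "Determinant.det (bordered n c x y es fs) =
    (\<Sum>F\<in>Pow (set es). (-1) ^ card F * (\<Prod>e\<in>F. c e) *
      Determinant.det (bordered n c x y [] (fs @ filter (\<lambda>e. e \<in> F) es)))"
  using assms
proof (induction es arbitrary: fs)
  case (Cons e es)
  let ?g = "\<lambda>fs es F. (-1) ^ card F * (\<Prod>e\<in>F. c e) *
      Determinant.det (bordered n c x y [] (fs @ filter (\<lambda>e. e \<in> F) es))"
  have e: "e \<notin> set es" "distinct es"
    using Cons.prems by auto
  have inj: "inj_on (insert e) (Pow (set es))"
    using e by (auto simp: inj_on_def)
  have without: "?g fs es F = ?g fs (e # es) F" if "F \<subseteq> set es" for F
    using that e by auto
  have with_e: "- c e * ?g (fs @ [e]) es F = ?g fs (e # es) (insert e F)" if "F \<subseteq> set es" for F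
  proof -
    have "finite F" "e \<notin> F"
      using that e finite_subset by auto
    moreover have "filter (\<lambda>e'. e' = e \<or> e' \<in> F) es = filter (\<lambda>e. e \<in> F) es"
      using e by (intro filter_cong) auto
    ultimately show ?thesis
      by simp
  qed
  have "Determinant.det (bordered n c x y (e # es) fs) =
      (\<Sum>F\<in>Pow (set es). ?g fs es F) + (\<Sum>F\<in>Pow (set es). - c e * ?g (fs @ [e]) es F)"
    by (simp only: det_bordered_Cons Cons.IH[OF e(2)] diff_conv_add_uminus)
       (simp add: sum_distrib_left sum_negf)
  also have "(\<Sum>F\<in>Pow (set es). ?g fs es F) = (\<Sum>F\<in>Pow (set es). ?g fs (e # es) F)"
    using without by (intro sum.cong) auto
  also have "(\<Sum>F\<in>Pow (set es). - c e * ?g (fs @ [e]) es F) =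
      (\<Sum>F\<in>Pow (set es). ?g fs (e # es) (insert e F))"
    using with_e by (intro sum.cong) auto
  also have "\<dots> = (\<Sum>F\<in>insert e ` Pow (set es). ?g fs (e # es) F)"
    by (subst sum.reindex[OF inj]) simp
  also have "(\<Sum>F\<in>Pow (set es). ?g fs (e # es) F) + \<dots> = (\<Sum>F\<in>Pow (set (e # es)). ?g fs (e # es) F)"
    using e unfolding list.set Pow_insert by (subst sum.union_disjoint) auto
  finally show ?case .
qed simp

text \<open>
  The Cauchy--Binet formula for \<open>X diag(c) Y\<^sup>T\<close>. A set \<open>F\<close> of columns is listed in the order of
  \<open>es\<close>; the order is irrelevant for the product of the two minors, but both must use the same one.
\<close>

lemma cauchy_binet:
  fixes c :: "'e \<Rightarrow> real" and x y :: "'e \<Rightarrow> nat \<Rightarrow> real"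
  assumes "distinct es"
  shows "Determinant.det (mat n n (\<lambda>(i, j). \<Sum>e\<leftarrow>es. c e * x e i * y e j)) =
    (\<Sum>F | F \<subseteq> set es \<and> card F = n. (\<Prod>e\<in>F. c e) *
      Determinant.det (mat n n (\<lambda>(i, j). x (filter (\<lambda>e. e \<in> F) es ! j) i)) *
      Determinant.det (mat n n (\<lambda>(i, j). y (filter (\<lambda>e. e \<in> F) es ! j) i)))"
proof -
  have len: "length (filter (\<lambda>e. e \<in> F) es) = card F" if "F \<subseteq> set es" for F
  proof -
    have "set (filter (\<lambda>e. e \<in> F) es) = F"
      using that by auto
    then show ?thesis
      using assms distinct_card[of "filter (\<lambda>e. e \<in> F) es"] by simp
  qed
  have sgn: "(-1) ^ n * P * ((-1) ^ n * X * Y) = P * X * Y" for P X Y :: real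
    by (simp add: power_add[symmetric] mult.assoc mult.left_commute)
  have "mat n n (\<lambda>(i, j). \<Sum>e\<leftarrow>es. c e * x e i * y e j) = bordered n c x y es []"
    by (rule eq_matI) (auto simp: bordered_def)
  then have "Determinant.det (mat n n (\<lambda>(i, j). \<Sum>e\<leftarrow>es. c e * x e i * y e j)) =
      (\<Sum>F\<in>Pow (set es). if card F = n then (\<Prod>e\<in>F. c e) *
        Determinant.det (mat n n (\<lambda>(i, j). x (filter (\<lambda>e. e \<in> F) es ! j) i)) *
        Determinant.det (mat n n (\<lambda>(i, j). y (filter (\<lambda>e. e \<in> F) es ! j) i)) else 0)"
    by (auto simp: det_bordered[OF assms, of n c x y "[]"] det_bordered_Nil len sgn intro!: sum.cong)
  also have "\<dots> = (\<Sum>F | F \<in> Pow (set es) \<and> card F = n. (\<Prod>e\<in>F. c e) *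
        Determinant.det (mat n n (\<lambda>(i, j). x (filter (\<lambda>e. e \<in> F) es ! j) i)) *
        Determinant.det (mat n n (\<lambda>(i, j). y (filter (\<lambda>e. e \<in> F) es ! j) i)))"
    by (rule sum.inter_filter[symmetric]) simp
  finally show ?thesis
    by (simp add: Pow_def)
qed

section \<open>Connections and cycles\<close>

lemma connection_refl [simp]: "(u, u) \<in> connection G F"
  by (simp add: connection_def)

lemma connection_sym: "(u, w) \<in> connection G F \<Longrightarrow> (w, u) \<in> connection G F"
proof -
  have "sym {(u, w). \<exists>e\<in>F. ends G e = {u, w}}"
    by (auto simp: sym_def insert_commute)
  then show "(u, w) \<in> connection G F \<Longrightarrow> (w, u) \<in> connection G F"
    unfolding connection_def by (meson sym_rtrancl symE)
qed

lemma connection_trans: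
  "(u, v) \<in> connection G F \<Longrightarrow> (v, w) \<in> connection G F \<Longrightarrow> (u, w) \<in> connection G F"
  unfolding connection_def by (rule rtrancl_trans)

lemma connection_edge: "e \<in> F \<Longrightarrow> ends G e = {u, w} \<Longrightarrow> (u, w) \<in> connection G F"
  unfolding connection_def by (rule r_into_rtrancl) auto

lemma connection_induct [consumes 1, case_names refl step]:
  assumes "(u, w) \<in> connection G F" and "P u"
    and "\<And>w w' e. (u, w) \<in> connection G F \<Longrightarrow> P w \<Longrightarrow> e \<in> F \<Longrightarrow> ends G e = {w, w'} \<Longrightarrow> P w'"
  shows "P w"
  using assms(1)[unfolded connection_def]
proof (induction rule: rtrancl_induct)
  case (step y z)
  then show ?case
    using assms(3)[of y] unfolding connection_def by blast
qed (fact assms(2))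

text \<open>
  A walk is shortened as it is built: when the next vertex has been visited before, the path is cut off
  there, and otherwise the new edge is not on the path because one of its ends is new.
\<close>

lemma connection_simple_path:
  assumes "(u, w) \<in> connection G F"
  obtains vs es where "distinct vs" "distinct es" "set es \<subseteq> F" "length vs = Suc (length es)"
    "vs ! 0 = u" "vs ! length es = w"
    "\<And>k. k < length es \<Longrightarrow> ends G (es ! k) = {vs ! k, vs ! Suc k}"
proof -
  have "\<exists>vs es. distinct vs \<and> distinct es \<and> set es \<subseteq> F \<and> length vs = Suc (length es) \<and>
      vs ! 0 = u \<and> vs ! length es = w \<and>
      (\<forall>k<length es. ends G (es ! k) = {vs ! k, vs ! Suc k})"
    using assms
  proof (induction rule: connection_induct)
    case refl
    show ?case
      by (rule exI[of _ "[u]"], rule exI[of _ "[]"]) simp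
  next
    case (step w w' e)
    from step.IH obtain vs es where p: "distinct vs" "distinct es" "set es \<subseteq> F"
      "length vs = Suc (length es)" "vs ! 0 = u" "vs ! length es = w"
      "\<And>k. k < length es \<Longrightarrow> ends G (es ! k) = {vs ! k, vs ! Suc k}"
      by blast
    show ?case
    proof (cases "w' \<in> set vs")
      case True
      then obtain l where l: "l \<le> length es" "vs ! l = w'"
        using p(4) by (metis in_set_conv_nth less_Suc_eq_le)
      show ?thesis
        using p l
        by (intro exI[of _ "take (Suc l) vs"] exI[of _ "take l es"])
          (auto dest: in_set_takeD)
    next
      case False
      have "e \<notin> set es"
      proof
        assume "e \<in> set es"
        then obtain k where k: "k < length es" "es ! k = e"
          by (auto simp: in_set_conv_nth)
        then have "w' \<in> {vs ! k, vs ! Suc k}"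
          using p(7)[of k] step.hyps by auto
        then show False
          using False k p(4) by auto
      qed
      with False p step.hyps show ?thesis
        by (intro exI[of _ "vs @ [w']"] exI[of _ "es @ [e]"])
          (auto simp: nth_append less_Suc_eq)
    qed
  qed
  then show thesis
    using that by blast
qed

text \<open>
  Closed vertex and edge lists are awkward in linear algebra arguments. Having a redundant edge, whose
  ends stay connected without it, is the form of \<open>is_cycle\<close> that is used from here on.
\<close>

lemma has_cycle_iff_redundant_edge:
  "(\<exists>vs es. is_cycle G vs es \<and> set es \<subseteq> F) \<longleftrightarrow>
    (\<exists>e\<in>F. \<exists>u w. ends G e = {u, w} \<and> (u, w) \<in> connection G (F - {e}))"
proof safe
  fix vs es
  assume c: "is_cycle G vs es" and F: "set es \<subseteq> F"
  define n where "n = length es - 1"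
  have len: "length es = Suc n" "length vs = Suc n"
    using c by (auto simp: is_cycle_def n_def)
  have ends: "ends G (es ! k) = {vs ! k, vs ! (Suc k mod Suc n)}" if "k \<le> n" for k
    using c that len by (auto simp: is_cycle_def)
  have d: "distinct es"
    using c by (simp add: is_cycle_def)
  let ?e = "es ! n"
  have "(vs ! 0, vs ! k) \<in> connection G (F - {?e})" if "k \<le> n" for k
    using that
  proof (induction k)
    case (Suc k)
    have "es ! k \<in> F - {?e}"
      using Suc.prems F len d by (auto simp: nth_eq_iff_index_eq)
    moreover have "ends G (es ! k) = {vs ! k, vs ! Suc k}"
      using ends[of k] Suc.prems by simp
    ultimately have "(vs ! k, vs ! Suc k) \<in> connection G (F - {?e})"
      by (rule connection_edge)
    with Suc show ?case
      by (meson Suc_leD connection_trans)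
  qed simp
  then show "\<exists>e\<in>F. \<exists>u w. ends G e = {u, w} \<and> (u, w) \<in> connection G (F - {e})"
    using ends[of n] F len
    by (intro bexI[of _ ?e] exI[of _ "vs ! 0"] exI[of _ "vs ! n"]) auto
next
  fix e u w
  assume e: "e \<in> F" "ends G e = {u, w}" and "(u, w) \<in> connection G (F - {e})"
  then obtain vs es where p: "distinct vs" "distinct es" "set es \<subseteq> F - {e}"
      "length vs = Suc (length es)" "vs ! 0 = u" "vs ! length es = w"
      "\<And>k. k < length es \<Longrightarrow> ends G (es ! k) = {vs ! k, vs ! Suc k}"
    using connection_simple_path by metis
  moreover have "Suc k mod Suc (length es) = Suc k" if "k < length es" for k
    using that by simp
  ultimately have "is_cycle G vs (es @ [e])"
    using e by (auto simp: is_cycle_def nth_append less_Suc_eq)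
  then show "\<exists>vs es. is_cycle G vs es \<and> set es \<subseteq> F"
    using p e by (intro exI[of _ vs] exI[of _ "es @ [e]"]) auto
qed

section \<open>Incidence vectors\<close>

context finite_network
begin

text \<open>
  Each edge gets an arbitrary direction, and \<open>incidence e\<close> is the column of the signed incidence
  matrix for \<open>e\<close>; it is 0 for a loop.
\<close>

definition orientation :: "'e \<Rightarrow> 'v \<times> 'v" where
  "orientation = (SOME f. \<forall>e\<in>edges G. fst (f e) \<in> verts G \<and> snd (f e) \<in> verts G \<and>
     ends G e = {fst (f e), snd (f e)})"

definition incidence :: "'e \<Rightarrow> 'v \<Rightarrow> real" where
  "incidence e v = of_bool (v = fst (orientation e)) - of_bool (v = snd (orientation e))"

lemma orientation:
  assumes "e \<in> edges G"
  shows "fst (orientation e) \<in> verts G" "snd (orientation e) \<in> verts G"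
    "ends G e = {fst (orientation e), snd (orientation e)}"
proof -
  have "\<forall>e\<in>edges G. \<exists>p. fst p \<in> verts G \<and> snd p \<in> verts G \<and> ends G e = {fst p, snd p}"
    using ends_edge by (metis fst_conv snd_conv)
  then have "\<exists>f. \<forall>e\<in>edges G. fst (f e) \<in> verts G \<and> snd (f e) \<in> verts G \<and>
      ends G e = {fst (f e), snd (f e)}"
    by (rule bchoice)
  from someI_ex[OF this, folded orientation_def] show "fst (orientation e) \<in> verts G" "snd (orientation e) \<in> verts G"
    "ends G e = {fst (orientation e), snd (orientation e)}"
    using assms by blast+
qed

lemma incidence_Ints: "incidence e v \<in> \<int>"
  by (simp add: incidence_def)

text \<open>
  Reversing an edge only changes the sign of its column, so that a path can run through an edge in the
  direction opposite to \<open>orientation\<close>.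
\<close>

lemma incidence_ends:
  assumes "e \<in> edges G" "ends G e = {u, w}"
  shows "\<exists>s :: real. s \<in> \<int> \<and> s * s = 1 \<and>
    (\<forall>v. s * incidence e v = of_bool (v = u) - of_bool (v = w))"
proof -
  have "orientation e = (u, w) \<or> orientation e = (w, u)"
    using orientation(3)[OF assms(1)] assms(2) by (auto simp: doubleton_eq_iff prod_eq_iff)
  then show ?thesis
  proof
    assume "orientation e = (u, w)"
    then show ?thesis
      by (intro exI[of _ 1]) (simp add: incidence_def)
  next
    assume "orientation e = (w, u)"
    then show ?thesis
      by (intro exI[of _ "-1"]) (simp add: incidence_def)
  qed
qed

lemma sum_incidence:
  assumes "finite T"
  shows "(\<Sum>v\<in>T. incidence e v) = of_bool (fst (orientation e) \<in> T) - of_bool (snd (orientation e) \<in> T)"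
proof -
  have "(\<Sum>v\<in>T. of_bool (v = u)) = (of_bool (u \<in> T) :: real)" for u
    unfolding of_bool_def using assms by (simp only: sum.delta)
  then show ?thesis
    by (simp only: incidence_def sum_subtractf)
qed

text \<open>
  Both ends of an edge of \<open>F\<close> lie in the same component, so its two entries cancel or are both absent.
\<close>

lemma sum_incidence_component:
  assumes "F \<subseteq> edges G" "e \<in> F"
  shows "(\<Sum>v | v \<in> verts G \<and> (u, v) \<in> connection G F. incidence e v) = 0"
proof -
  have e: "e \<in> edges G"
    using assms by auto
  have c: "(fst (orientation e), snd (orientation e)) \<in> connection G F"
    using assms(2) orientation(3)[OF e] by (rule connection_edge)
  have "(u, fst (orientation e)) \<in> connection G F \<longleftrightarrow> (u, snd (orientation e)) \<in> connection G F"
    using connection_trans[OF _ c] connection_trans[OF _ connection_sym[OF c]] by blast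
  then show ?thesis
    using finite_verts orientation(1,2)[OF e] by (simp add: sum_incidence)
qed

text \<open>
  The signed sum of the edges along a path telescopes. That the coefficients are integers is what will
  make the minors of incidence matrices equal to 0, 1 or -1.
\<close>

lemma connection_incidence_combination:
  assumes F: "F \<subseteq> edges G" and c: "(u, w) \<in> connection G F"
  shows "\<exists>z. (\<forall>e. z e \<in> \<int>) \<and>
      (\<forall>v. (\<Sum>e\<in>F. z e * incidence e v) = of_bool (v = u) - of_bool (v = w))"
  using c
proof (induction rule: connection_induct)
  case refl
  show ?case
    by (rule exI[of _ "\<lambda>_. 0"]) simp
next
  case (step w w' e)
  have finF: "finite F"
    using F finite_edges by (rule finite_subset)
  from step.IH obtain z where z: "\<And>e. z e \<in> \<int>"
    "\<And>v. (\<Sum>e\<in>F. z e * incidence e v) = of_bool (v = u) - of_bool (v = w)"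
    by blast
  have "e \<in> edges G"
    using step.hyps F by auto
  then obtain s where s: "s \<in> \<int>" "\<And>v. s * incidence e v = of_bool (v = w) - of_bool (v = w')"
    using incidence_ends[OF _ step.hyps(3)] by blast
  have "(\<Sum>f\<in>F. (z f + s * of_bool (f = e)) * incidence f v) = of_bool (v = u) - of_bool (v = w')"
    for v
  proof -
    have "(\<Sum>f\<in>F. (z f + s * of_bool (f = e)) * incidence f v) =
        (\<Sum>f\<in>F. z f * incidence f v) + (\<Sum>f\<in>F. if f = e then s * incidence f v else 0)"
      by (subst sum.distrib[symmetric]) (auto intro!: sum.cong simp: algebra_simps)
    then show ?thesis
      using finF step.hyps by (simp add: z s)
  qed
  then show ?case
    using z s by (intro exI[of _ "\<lambda>f. z f + s * of_bool (f = e)"]) auto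
qed

text \<open>
  Removing the edge \<open>e\<close> from a forest separates its ends. Adding up the relation over the vertices on
  one side cancels all other edges and leaves \<open>z e\<close> up to sign.
\<close>

lemma spanning_forest_incidence_independent:
  assumes F: "spanning_forest G F" and e: "e \<in> F"
    and z: "\<And>v. v \<in> verts G \<Longrightarrow> (\<Sum>e\<in>F. z e * incidence e v) = 0"
  shows "z e = 0"
proof -
  have FE: "F \<subseteq> edges G" and nc: "\<not> (\<exists>vs es. is_cycle G vs es \<and> set es \<subseteq> F)"
    using F by (auto simp: spanning_forest_def)
  have finF: "finite F"
    using FE finite_edges by (rule finite_subset)
  have eE: "e \<in> edges G"
    using e FE by auto
  define u where "u = fst (orientation e)"
  define w where "w = snd (orientation e)"
  define T where "T = {v. v \<in> verts G \<and> (u, v) \<in> connection G (F - {e})}"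
  have finT: "finite T"
    using finite_verts by (simp add: T_def)
  have uw: "ends G e = {u, w}" "u \<in> verts G"
    using orientation[OF eE] by (auto simp: u_def w_def)
  have "u \<in> T"
    using uw by (simp add: T_def)
  have "w \<notin> T"
    using nc e uw unfolding has_cycle_iff_redundant_edge T_def by blast
  then have "(\<Sum>v\<in>T. incidence e v) = 1"
    using \<open>u \<in> T\<close> by (simp add: sum_incidence[OF finT] flip: u_def w_def)
  moreover have "(\<Sum>v\<in>T. incidence f v) = 0" if "f \<in> F - {e}" for f
    using that FE unfolding T_def by (intro sum_incidence_component) auto
  ultimately have "(\<Sum>f\<in>F. z f * (\<Sum>v\<in>T. incidence f v)) = z e"
    using finF e by (simp add: sum.remove[of F e])
  moreover have "(\<Sum>f\<in>F. z f * (\<Sum>v\<in>T. incidence f v)) = (\<Sum>v\<in>T. \<Sum>f\<in>F. z f * incidence f v)"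
    by (simp add: sum_distrib_left) (rule sum.swap)
  moreover have "\<dots> = 0"
    using z by (intro sum.neutral) (auto simp: T_def)
  ultimately show ?thesis
    by simp
qed

text \<open>
  A redundant edge is, up to sign, the combination of the edges on a path between its ends.
\<close>

lemma incidence_dependent_if_not_forest:
  assumes F: "F \<subseteq> edges G" "\<not> spanning_forest G F"
  obtains z e where "e \<in> F" "z e \<noteq> 0" "\<And>v. (\<Sum>e\<in>F. z e * incidence e v) = 0"
proof -
  from F obtain e u w where e: "e \<in> F" "ends G e = {u, w}" "(u, w) \<in> connection G (F - {e})"
    unfolding spanning_forest_def has_cycle_iff_redundant_edge by blast
  have finF: "finite F"
    using F(1) finite_edges by (rule finite_subset)
  obtain z where z: "\<And>v. (\<Sum>e\<in>F - {e}. z e * incidence e v) = of_bool (v = u) - of_bool (v = w)"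
    using connection_incidence_combination[OF _ e(3)] F(1) by blast
  obtain s :: real where s: "s * s = 1" "\<And>v. s * incidence e v = of_bool (v = u) - of_bool (v = w)"
    using incidence_ends[OF _ e(2)] e(1) F(1) by blast
  have "(\<Sum>f\<in>F. (z(e := - s)) f * incidence f v) = 0" for v
  proof -
    have "(\<Sum>f\<in>F - {e}. (z(e := - s)) f * incidence f v) = (\<Sum>f\<in>F - {e}. z f * incidence f v)"
      by (intro sum.cong) auto
    then show ?thesis
      using finF e s(2)[of v] z[of v] by (simp add: sum.remove[of F e])
  qed
  moreover have "s \<noteq> 0"
    using s(1) by auto
  ultimately show thesis
    using that[of e "z(e := - s)"] e(1) by auto
qed

end

section \<open>Minors of incidence matrices\<close>

lemma sum_nth_distinct:
  assumes "distinct xs"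
  shows "(\<Sum>i<length xs. g (xs ! i)) = (\<Sum>x\<in>set xs. g x)"
  by (rule sum.reindex_bij_betw[OF bij_betw_nth[OF assms refl refl]])

lemma sum_lessThan_add:
  fixes g :: "nat \<Rightarrow> 'c :: comm_monoid_add"
  shows "(\<Sum>i<m + n. g i) = (\<Sum>i<m. g i) + (\<Sum>i<n. g (m + i))"
  by (induction n) (simp_all add: add.assoc)

lemma det_eq_0_if_columns_dependent:
  fixes A :: "real mat"
  assumes A: "A \<in> carrier_mat n n" and "j < n" "t j \<noteq> 0"
    and t: "\<And>k. k < n \<Longrightarrow> (\<Sum>l<n. A $$ (k, l) * t l) = 0"
  shows "Determinant.det A = 0"
proof -
  have "vec n t \<noteq> 0\<^sub>v n"
    using assms(2,3) by (metis index_vec index_zero_vec(1))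
  moreover have "A *\<^sub>v vec n t = 0\<^sub>v n"
    using A t by (intro eq_vecI) (auto simp: scalar_prod_def atLeast0LessThan)
  ultimately show ?thesis
    unfolding det_0_iff_vec_prod_zero[OF A] by (intro exI[of _ "vec n t"]) simp
qed

lemma det_eq_0_if_rows_dependent:
  fixes A :: "real mat"
  assumes A: "A \<in> carrier_mat n n" and "j < n" "t j \<noteq> 0"
    and t: "\<And>l. l < n \<Longrightarrow> (\<Sum>k<n. t k * A $$ (k, l)) = 0"
  shows "Determinant.det A = 0"
proof -
  have "Determinant.det A\<^sup>T = 0"
  proof (rule det_eq_0_if_columns_dependent)
    show "(\<Sum>l<n. A\<^sup>T $$ (k, l) * t l) = 0" if "k < n" for k
      using t[OF that] A that by (simp add: mult.commute)
  qed (use assms in auto)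
  then show ?thesis
    by (simp add: det_transpose[OF A])
qed

lemma det_Ints:
  fixes A :: "real mat"
  assumes "A \<in> carrier_mat n n" "\<And>i j. i < n \<Longrightarrow> j < n \<Longrightarrow> A $$ (i, j) \<in> \<int>"
  shows "Determinant.det A \<in> \<int>"
proof -
  have "(signof p * (\<Prod>i = 0..<n. A $$ (i, p i)) :: real) \<in> \<int>" if "p permutes {0..<n}" for p
    using assms(2) permutes_in_image[OF that] by (intro Ints_mult Ints_prod) auto
  then show ?thesis
    unfolding det_def'[OF assms(1)] by (intro Ints_sum) auto
qed

context finite_network
begin

text \<open>
  Rows are indexed by the vertices in \<open>p\<close> and columns by the edges in \<open>fs\<close>. The matrix is always
  square, so it is only meaningful if \<open>fs\<close> is as long as \<open>p\<close>.
\<close>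

definition incidence_mat :: "'v list \<Rightarrow> 'e list \<Rightarrow> real mat" where
  "incidence_mat p fs = mat (length p) (length p) (\<lambda>(k, l). incidence (fs ! l) (p ! k))"

lemma incidence_mat_carrier: "incidence_mat p fs \<in> carrier_mat (length p) (length p)"
  by (simp add: incidence_mat_def)

text \<open>
  The set \<open>R\<close> is thought of as the vertices whose rows are deleted from the incidence matrix.
\<close>

definition grounded :: "'e set \<Rightarrow> 'v set \<Rightarrow> bool" where
  "grounded F R \<longleftrightarrow> (\<forall>v\<in>verts G. \<exists>r\<in>R. (v, r) \<in> connection G F)"

text \<open>
  If a component avoids the deleted rows, then all of its rows are present and they add up to 0.
\<close>

lemma det_incidence_mat_eq_0:
  assumes fs: "set fs \<subseteq> edges G" "length fs = length p" and p: "distinct p"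
    and ng: "\<not> grounded (set fs) (verts G - set p)"
  shows "Determinant.det (incidence_mat p fs) = 0"
proof -
  obtain v where v: "v \<in> verts G" "\<And>r. r \<in> verts G - set p \<Longrightarrow> (v, r) \<notin> connection G (set fs)"
    using ng by (auto simp: grounded_def)
  let ?T = "{w. w \<in> verts G \<and> (v, w) \<in> connection G (set fs)}"
  have T: "?T \<subseteq> set p"
    using v by auto
  have "v \<in> ?T"
    using v by simp
  then obtain j where j: "j < length p" "p ! j = v"
    using T by (metis in_set_conv_nth subsetD)
  show ?thesis
  proof (rule det_eq_0_if_rows_dependent[OF incidence_mat_carrier j(1)])
    show "of_bool (p ! j \<in> ?T) \<noteq> (0 :: real)"
      using \<open>v \<in> ?T\<close> j by simp
    fix l
    assume l: "l < length p"
    have "(\<Sum>k<length p. of_bool (p ! k \<in> ?T) * incidence_mat p fs $$ (k, l)) =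
        (\<Sum>k<length p. of_bool (p ! k \<in> ?T) * incidence (fs ! l) (p ! k))"
      using l by (simp add: incidence_mat_def)
    also have "\<dots> = (\<Sum>w\<in>set p. of_bool (w \<in> ?T) * incidence (fs ! l) w)"
      by (rule sum_nth_distinct[OF p])
    also have "\<dots> = (\<Sum>w\<in>?T. incidence (fs ! l) w)"
      using T by (intro sum.mono_neutral_cong_right) auto
    also have "\<dots> = 0"
      using fs l by (intro sum_incidence_component) auto
    finally show "(\<Sum>k<length p. of_bool (p ! k \<in> ?T) * incidence_mat p fs $$ (k, l)) = 0" .
  qed
qed

text \<open>
  A path from \<open>p ! k\<close> to a vertex with a deleted row expresses the \<open>k\<close>-th unit vector as an integer
  combination of columns. Hence the matrix has an integer right inverse and its determinant is a unit
  of the integers.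
\<close>

lemma det_incidence_mat_squared:
  assumes fs: "distinct fs" "set fs \<subseteq> edges G" "length fs = length p"
    and p: "distinct p" "set p \<subseteq> verts G"
    and g: "grounded (set fs) (verts G - set p)"
  shows "Determinant.det (incidence_mat p fs) * Determinant.det (incidence_mat p fs) = 1"
proof -
  let ?N = "length p"
  have "\<exists>z. (\<forall>e. z e \<in> \<int>) \<and> (\<forall>v\<in>set p. (\<Sum>e\<in>set fs. z e * incidence e v) = of_bool (v = p ! k))"
    if k: "k < ?N" for k
  proof -
    have "p ! k \<in> verts G"
      using k p by auto
    then obtain r where r: "r \<in> verts G - set p" "(p ! k, r) \<in> connection G (set fs)"
      using g by (auto simp: grounded_def)
    obtain z where "\<forall>e. z e \<in> \<int>"
      "\<forall>v. (\<Sum>e\<in>set fs. z e * incidence e v) = of_bool (v = p ! k) - of_bool (v = r)"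
      using connection_incidence_combination[OF fs(2) r(2)] by blast
    then show ?thesis
      using r by (intro exI[of _ z]) auto
  qed
  then have "\<exists>z. \<forall>k\<in>{..<?N}. (\<forall>e. z k e \<in> \<int>) \<and>
      (\<forall>v\<in>set p. (\<Sum>e\<in>set fs. z k e * incidence e v) = of_bool (v = p ! k))"
    by (intro bchoice) auto
  then obtain z where z: "\<And>k e. k < ?N \<Longrightarrow> z k e \<in> \<int>"
    "\<And>k v. k < ?N \<Longrightarrow> v \<in> set p \<Longrightarrow> (\<Sum>e\<in>set fs. z k e * incidence e v) = of_bool (v = p ! k)"
    by blast
  define Y where "Y = mat ?N ?N (\<lambda>(l, k). z k (fs ! l))"
  have Y: "Y \<in> carrier_mat ?N ?N"
    by (simp add: Y_def)
  let ?X = "incidence_mat p fs"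
  have XY: "?X * Y = 1\<^sub>m ?N"
  proof (rule eq_matI)
    fix i k
    assume "i < dim_row (1\<^sub>m ?N)" "k < dim_col (1\<^sub>m ?N)"
    then have ik: "i < ?N" "k < ?N"
      by auto
    have "(?X * Y) $$ (i, k) = (\<Sum>l<?N. ?X $$ (i, l) * Y $$ (l, k))"
      by (rule index_mult_mat_sum[OF incidence_mat_carrier Y ik])
    also have "\<dots> = (\<Sum>l<length fs. z k (fs ! l) * incidence (fs ! l) (p ! i))"
      using ik fs by (intro sum.cong) (auto simp: incidence_mat_def Y_def)
    also have "\<dots> = (\<Sum>e\<in>set fs. z k e * incidence e (p ! i))"
      by (rule sum_nth_distinct[OF fs(1)])
    also have "\<dots> = of_bool (p ! i = p ! k)"
      using ik by (intro z) auto
    finally show "(?X * Y) $$ (i, k) = 1\<^sub>m ?N $$ (i, k)"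
      using ik p by (simp add: nth_eq_iff_index_eq)
  qed (simp_all add: incidence_mat_def Y_def)
  have "Determinant.det ?X * Determinant.det Y = 1"
    by (simp add: XY flip: det_mult[OF incidence_mat_carrier Y])
  moreover have "Determinant.det ?X \<in> \<int>"
    by (rule det_Ints[OF incidence_mat_carrier]) (simp add: incidence_mat_def incidence_Ints)
  moreover have "Determinant.det Y \<in> \<int>"
    by (rule det_Ints[OF Y]) (simp add: Y_def z)
  ultimately obtain i j :: int where ij: "Determinant.det ?X = of_int i" "Determinant.det Y = of_int j"
    "of_int i * of_int j = (1 :: real)"
    by (metis Ints_cases)
  then have "i * j = 1"
    by (metis of_int_eq_1_iff of_int_mult)
  then have "i * i = 1"
    by (auto simp: zmult_eq_1_iff)
  then show ?thesis
    unfolding ij(1) by (metis of_int_1 of_int_mult)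
qed

text \<open>
  A relation between columns only has to hold on the rows that are kept. This gives both that \<open>fs\<close> is
  a forest and that no two deleted rows belong to the same component, since a path between the latter
  is a relation on the rows that are kept.
\<close>

lemma incidence_independent_if_det_nonzero:
  assumes fs: "distinct fs" "length fs = length p"
    and det: "Determinant.det (incidence_mat p fs) \<noteq> 0"
    and z: "\<And>v. v \<in> set p \<Longrightarrow> (\<Sum>e\<in>set fs. z e * incidence e v) = 0" and e: "e \<in> set fs"
  shows "z e = 0"
proof (rule ccontr)
  assume "z e \<noteq> 0"
  obtain j where j: "j < length p" "fs ! j = e"
    using e fs by (metis in_set_conv_nth)
  have "Determinant.det (incidence_mat p fs) = 0"
  proof (rule det_eq_0_if_columns_dependent[OF incidence_mat_carrier j(1)])
    show "z (fs ! j) \<noteq> 0"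
      using \<open>z e \<noteq> 0\<close> j by simp
    fix k
    assume k: "k < length p"
    have "(\<Sum>l<length p. incidence_mat p fs $$ (k, l) * z (fs ! l)) =
        (\<Sum>l<length fs. z (fs ! l) * incidence (fs ! l) (p ! k))"
      using k fs by (intro sum.cong) (auto simp: incidence_mat_def)
    also have "\<dots> = (\<Sum>e\<in>set fs. z e * incidence e (p ! k))"
      by (rule sum_nth_distinct[OF fs(1)])
    also have "\<dots> = 0"
      using k by (intro z) auto
    finally show "(\<Sum>l<length p. incidence_mat p fs $$ (k, l) * z (fs ! l)) = 0" .
  qed
  with det show False
    by simp
qed

lemma spanning_forest_if_det_nonzero:
  assumes fs: "distinct fs" "set fs \<subseteq> edges G" "length fs = length p"
    and det: "Determinant.det (incidence_mat p fs) \<noteq> 0"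
  shows "spanning_forest G (set fs)"
proof (rule ccontr)
  assume "\<not> ?thesis"
  then show False
    by (rule incidence_dependent_if_not_forest[OF fs(2)])
      (use incidence_independent_if_det_nonzero[OF fs(1,3) det] in blast)
qed

lemma roots_separated_if_det_nonzero:
  assumes fs: "distinct fs" "set fs \<subseteq> edges G" "length fs = length p"
    and det: "Determinant.det (incidence_mat p fs) \<noteq> 0"
    and r: "r \<notin> set p" "r' \<notin> set p" "(r, r') \<in> connection G (set fs)"
  shows "r = r'"
proof (rule ccontr)
  assume "r \<noteq> r'"
  obtain z where z: "\<And>v. (\<Sum>e\<in>set fs. z e * incidence e v) = of_bool (v = r) - of_bool (v = r')"
    using connection_incidence_combination[OF fs(2) r(3)] by blast
  have "(\<Sum>e\<in>set fs. z e * incidence e v) = 0" if "v \<in> set p" for v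
    unfolding z using r that by (auto simp: of_bool_def)
  then have "z e = 0" if "e \<in> set fs" for e
    using incidence_independent_if_det_nonzero[OF fs(1,3) det] that by blast
  then have "(\<Sum>e\<in>set fs. z e * incidence e r) = 0"
    by (intro sum.neutral) auto
  with z[of r] \<open>r \<noteq> r'\<close> show False
    by simp
qed

text \<open>
  Let \<open>X\<close> be the incidence matrix of \<open>F\<close> restricted to the rows in \<open>S\<close>. Paths to the vertices outside
  \<open>S\<close> give a right inverse \<open>Y\<close> of \<open>X\<close>, so \<open>X (Y X - 1) = 0\<close>. As the components are separated by the vertices
  outside \<open>S\<close> and \<open>F\<close> is a forest, \<open>X\<close> is injective, which makes \<open>Y\<close> a left inverse too. Now \<open>card F\<close> and
  \<open>card S\<close> are the traces of \<open>Y X\<close> and \<open>X Y\<close>.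
\<close>

lemma card_spanning_forest:
  assumes F: "spanning_forest G F" and S: "S \<subseteq> verts G"
    and g: "grounded F (verts G - S)"
    and sep: "\<And>r r'. r \<in> verts G - S \<Longrightarrow> r' \<in> verts G - S \<Longrightarrow> (r, r') \<in> connection G F \<Longrightarrow> r = r'"
  shows "card F = card S"
proof -
  have FE: "F \<subseteq> edges G"
    using F by (simp add: spanning_forest_def)
  have fin: "finite F" "finite S"
    using FE S finite_edges finite_verts finite_subset by blast+
  have "\<exists>z. \<forall>v\<in>S. (\<Sum>e\<in>F. z e * incidence e v) = of_bool (v = s)" if s: "s \<in> S" for s
  proof -
    obtain r where r: "r \<in> verts G - S" "(s, r) \<in> connection G F"
      using g s S by (auto simp: grounded_def)
    obtain z where "\<forall>v. (\<Sum>e\<in>F. z e * incidence e v) = of_bool (v = s) - of_bool (v = r)"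
      using connection_incidence_combination[OF FE r(2)] by blast
    then show ?thesis
      using r by (intro exI[of _ z]) auto
  qed
  then have "\<exists>z. \<forall>s\<in>S. \<forall>v\<in>S. (\<Sum>e\<in>F. z s e * incidence e v) = of_bool (v = s)"
    by (intro bchoice) auto
  then obtain z where z: "\<And>s v. s \<in> S \<Longrightarrow> v \<in> S \<Longrightarrow> (\<Sum>e\<in>F. z s e * incidence e v) = of_bool (v = s)"
    by blast
  have one: "(\<Sum>s\<in>S. incidence e s * z s e) = 1" if e: "e \<in> F" for e
  proof -
    \<comment> \<open>The vector \<open>y\<close> is the column of \<open>Y X - 1\<close> for \<open>e\<close>.\<close>
    define y where "y f = (\<Sum>s\<in>S. incidence e s * z s f) - of_bool (f = e)" for f
    define g where "g v = (\<Sum>f\<in>F. y f * incidence f v)" for v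
    have g0: "g v = 0" if v: "v \<in> S" for v
    proof -
      have "g v = (\<Sum>f\<in>F. (\<Sum>s\<in>S. incidence e s * (z s f * incidence f v)) -
          (if f = e then incidence f v else 0))"
        unfolding g_def y_def
        by (intro sum.cong) (auto simp: left_diff_distrib sum_distrib_right mult.assoc)
      also have "\<dots> = (\<Sum>s\<in>S. incidence e s * (\<Sum>f\<in>F. z s f * incidence f v)) - incidence e v"
        using fin e by (simp add: sum_subtractf sum_distrib_left sum.swap[of _ S F])
      also have "(\<Sum>s\<in>S. incidence e s * (\<Sum>f\<in>F. z s f * incidence f v)) =
          (\<Sum>s\<in>S. if s = v then incidence e v else 0)"
        using v by (intro sum.cong) (auto simp: z)
      finally show ?thesis
        using fin v by simp
    qed
    have "g v = 0" if v: "v \<in> verts G" for v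
    proof (cases "v \<in> S")
      case False
      \<comment> \<open>The values of \<open>g\<close> on a component add up to 0, and its only vertex outside \<open>S\<close> is \<open>v\<close>.\<close>
      let ?T = "{w. w \<in> verts G \<and> (v, w) \<in> connection G F}"
      have "g v = (\<Sum>w\<in>{v}. g w)"
        by simp
      also have "\<dots> = (\<Sum>w\<in>?T. g w)"
      proof (rule sum.mono_neutral_left)
        show "finite ?T"
          using finite_verts by simp
        show "\<forall>w\<in>?T - {v}. g w = 0"
          using sep[of v] g0 v False by auto
      qed (use v in auto)
      also have "\<dots> = (\<Sum>f\<in>F. y f * (\<Sum>w\<in>?T. incidence f w))"
        unfolding g_def sum_distrib_left by (rule sum.swap)
      also have "\<dots> = 0"
        using sum_incidence_component[OF FE] by simp
      finally show ?thesis .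
    qed (rule g0)
    then have "y e = 0"
      using spanning_forest_incidence_independent[OF F e, of y] by (simp add: g_def)
    then show ?thesis
      by (simp add: y_def)
  qed
  have "real (card F) = (\<Sum>e\<in>F. \<Sum>s\<in>S. incidence e s * z s e)"
    by (simp add: one)
  also have "\<dots> = (\<Sum>s\<in>S. \<Sum>e\<in>F. z s e * incidence e s)"
    by (subst sum.swap) (simp add: mult.commute)
  also have "\<dots> = real (card S)"
    by (simp add: z)
  finally show ?thesis
    by simp
qed

end

section \<open>The matrix tree theorem for all minors\<close>

context finite_network
begin

text \<open>
  The edge sets that contribute to the minor of the Laplacian with the rows \<open>a @ m\<close> and the columns
  \<open>b @ m\<close>: every component contains exactly one \<open>a ! k\<close> together with \<open>b ! \<pi> k\<close>, or exactly one vertex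
  of \<open>d\<close>. The number of edges stands for acyclicity and for the uniqueness of these vertices; it is
  what Cauchy--Binet provides.
\<close>

definition linking :: "'v list \<Rightarrow> 'v list \<Rightarrow> 'v list \<Rightarrow> 'v list \<Rightarrow> (nat \<Rightarrow> nat) \<Rightarrow> 'e set \<Rightarrow> bool" where
  "linking a b m d \<pi> F \<longleftrightarrow> F \<subseteq> edges G \<and> card F = length a + length m \<and>
     grounded F (set b \<union> set d) \<and> grounded F (set a \<union> set d) \<and>
     (\<forall>k<length a. (a ! k, b ! \<pi> k) \<in> connection G F)"

text \<open>
  The component of \<open>a ! k\<close> contains \<open>b ! \<pi> k\<close> and some vertices of \<open>m\<close>, and its rows add up to 0. So the
  row of \<open>a ! k\<close> is minus the row of \<open>b ! \<pi> k\<close> minus rows of \<open>m\<close>: replacing all \<open>a ! k\<close> by \<open>b ! \<pi> k\<close> changes the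
  determinant by \<open>(-1) ^ length a\<close>, and sorting the latter by the sign of \<open>\<pi>\<close>.
\<close>

lemma incidence_mat_change_roots:
  assumes fs: "set fs \<subseteq> edges G" "length fs = length a + length m"
    and len: "length a = length b"
    and dist: "distinct (a @ b @ m @ d)" and verts: "set (a @ b @ m @ d) = verts G"
    and sepa: "\<And>r r'. r \<in> set a \<union> set d \<Longrightarrow> r' \<in> set a \<union> set d \<Longrightarrow>
      (r, r') \<in> connection G (set fs) \<Longrightarrow> r = r'"
    and sepb: "\<And>r r'. r \<in> set b \<union> set d \<Longrightarrow> r' \<in> set b \<union> set d \<Longrightarrow>
      (r, r') \<in> connection G (set fs) \<Longrightarrow> r = r'"
    and \<pi>: "\<pi> permutes {..<length a}"
    and link: "\<And>k. k < length a \<Longrightarrow> (a ! k, b ! \<pi> k) \<in> connection G (set fs)"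
  shows "Determinant.det (incidence_mat (a @ m) fs) =
    (-1) ^ length a * of_int (sign \<pi>) * Determinant.det (incidence_mat (b @ m) fs)"
proof -
  let ?n = "length a" and ?M = "length m"
  let ?N = "?n + ?M"
  let ?c = "\<lambda>i v. (a ! i, v) \<in> connection G (set fs)"
  have \<pi>N: "\<pi> permutes {0..<?N}"
    by (rule permutes_subset[OF \<pi>]) auto
  have \<pi>lt: "\<pi> i < ?n" if "i < ?n" for i
    using permutes_in_image[OF \<pi>, of i] that by simp
  have \<pi>ge: "\<pi> i = i" if "\<not> i < ?n" for i
    using permutes_not_in[OF \<pi>, of i] that by simp
  define Q where "Q = mat ?N ?N (\<lambda>(i, l). incidence_mat (b @ m) fs $$ (\<pi> i, l))"
  define U :: "real mat" where "U = mat ?N ?N (\<lambda>(i, j).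
    if i < ?n then if j < ?n then if i = j then -1 else 0 else if ?c i (m ! (j - ?n)) then -1 else 0
    else if i = j then 1 else 0)"
  have Q: "Q \<in> carrier_mat ?N ?N" and U: "U \<in> carrier_mat ?N ?N"
    by (simp_all add: Q_def U_def)
  have P: "incidence_mat (a @ m) fs \<in> carrier_mat ?N ?N" "incidence_mat (b @ m) fs \<in> carrier_mat ?N ?N"
    using len by (simp_all add: incidence_mat_def)
  \<comment> \<open>Outside \<open>m\<close>, the component of \<open>a ! i\<close> consists of \<open>a ! i\<close> and \<open>b ! \<pi> i\<close>, and every column of the
    incidence matrix adds up to 0 over the component.\<close>
  have row: "incidence e (a ! i) =
      - incidence e (b ! \<pi> i) - (\<Sum>r<?M. if ?c i (m ! r) then incidence e (m ! r) else 0)"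
    if i: "i < ?n" and e: "e \<in> set fs" for i e
  proof -
    let ?T = "{v. v \<in> verts G \<and> ?c i v}"
    let ?S = "{v \<in> set m. ?c i v}"
    have ai: "a ! i \<in> set a" and bi: "b ! \<pi> i \<in> set b"
      using i \<pi>lt[OF i] len by simp_all
    have "x = b ! \<pi> i" if "x \<in> set b \<union> set d" "?c i x" for x
      using sepb[OF _ that(1) connection_trans[OF connection_sym[OF link[OF i]] that(2)]] bi by simp
    moreover have "x = a ! i" if "x \<in> set a \<union> set d" "?c i x" for x
      using sepa[of "a ! i" x] ai that by auto
    moreover have "set a \<inter> set b = {}" "(set a \<union> set b) \<inter> set m = {}" "set d \<inter> set b = {}"
      using dist by auto
    ultimately have T: "?T = insert (a ! i) (insert (b ! \<pi> i) ?S)"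
      and "a ! i \<notin> insert (b ! \<pi> i) ?S" "b ! \<pi> i \<notin> ?S"
      using ai bi link[OF i] unfolding verts[symmetric] by auto
    then have "(\<Sum>v\<in>?T. incidence e v) =
        incidence e (a ! i) + (incidence e (b ! \<pi> i) + (\<Sum>v\<in>?S. incidence e v))"
      unfolding T by (subst sum.insert, simp_all)+
    moreover have "(\<Sum>v\<in>?T. incidence e v) = 0"
      using fs(1) e by (rule sum_incidence_component)
    moreover have "(\<Sum>v\<in>?S. incidence e v) = (\<Sum>v\<in>set m. if ?c i v then incidence e v else 0)"
      by (rule sum.inter_filter) simp
    moreover have "\<dots> = (\<Sum>r<?M. if ?c i (m ! r) then incidence e (m ! r) else 0)"
      using dist by (intro sum_nth_distinct[symmetric]) auto
    ultimately show ?thesis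
      by linarith
  qed
  have "incidence_mat (a @ m) fs = U * Q"
  proof (rule eq_matI)
    fix i l
    assume "i < dim_row (U * Q)" "l < dim_col (U * Q)"
    then have il: "i < ?N" "l < ?N"
      using U Q by auto
    have Qlow: "Q $$ (r, l) = incidence (fs ! l) (b ! \<pi> r)" if "r < ?n" for r
      using that il \<pi>lt[OF that] len by (simp add: Q_def incidence_mat_def nth_append)
    have Qhigh: "Q $$ (?n + r, l) = incidence (fs ! l) (m ! r)" if "r < ?M" for r
      using that il \<pi>ge[of "?n + r"] len by (simp add: Q_def incidence_mat_def nth_append)
    have "(U * Q) $$ (i, l) = (\<Sum>r<?N. U $$ (i, r) * Q $$ (r, l))"
      by (rule index_mult_mat_sum[OF U Q il])
    also have "\<dots> = (\<Sum>r<?n. U $$ (i, r) * Q $$ (r, l)) + (\<Sum>r<?M. U $$ (i, ?n + r) * Q $$ (?n + r, l))"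
      by (rule sum_lessThan_add)
    also have "\<dots> = incidence (fs ! l) ((a @ m) ! i)"
    proof (cases "i < ?n")
      case True
      have "(\<Sum>r<?n. U $$ (i, r) * Q $$ (r, l)) =
          (\<Sum>r<?n. if r = i then - incidence (fs ! l) (b ! \<pi> i) else 0)"
        using True by (intro sum.cong) (auto simp: U_def Qlow)
      moreover have "(\<Sum>r<?M. U $$ (i, ?n + r) * Q $$ (?n + r, l)) =
          (\<Sum>r<?M. - (if ?c i (m ! r) then incidence (fs ! l) (m ! r) else 0))"
        using True by (intro sum.cong) (auto simp: U_def Qhigh)
      moreover have "fs ! l \<in> set fs"
        using il fs(2) by simp
      ultimately show ?thesis
        using True row[of i "fs ! l"] by (simp add: nth_append sum_negf)
    next
      case False
      have "(\<Sum>r<?n. U $$ (i, r) * Q $$ (r, l)) = 0"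
        using False il by (intro sum.neutral) (auto simp: U_def)
      moreover have "(\<Sum>r<?M. U $$ (i, ?n + r) * Q $$ (?n + r, l)) =
          (\<Sum>r<?M. if r = i - ?n then incidence (fs ! l) (m ! r) else 0)"
        using False il by (intro sum.cong) (auto simp: U_def Qhigh)
      ultimately show ?thesis
        using False il by (simp add: nth_append)
    qed
    finally show "incidence_mat (a @ m) fs $$ (i, l) = (U * Q) $$ (i, l)"
      using il by (simp add: incidence_mat_def)
  qed (use P U Q in auto)
  then have "Determinant.det (incidence_mat (a @ m) fs) = Determinant.det U * Determinant.det Q"
    by (simp add: det_mult[OF U Q])
  also have "Determinant.det U = prod_list (diag_mat U)"
    by (rule det_upper_triangular[OF _ U]) (auto simp: upper_triangular_def U_def)
  also have "diag_mat U = replicate ?n (-1) @ replicate ?M 1"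
    by (rule nth_equalityI) (auto simp: diag_mat_def U_def nth_append)
  also have "prod_list \<dots> = (-1) ^ ?n"
    by (simp add: prod_list_replicate)
  also have "Determinant.det Q = signof \<pi> * Determinant.det (incidence_mat (b @ m) fs)"
    unfolding Q_def by (rule det_permute_rows[OF P(2) \<pi>N])
  finally show ?thesis
    by simp
qed

text \<open>
  If both minors are nonzero, then each component contains exactly one vertex of \<open>b @ d\<close> and exactly
  one of \<open>a @ d\<close>. Matching them up shows that the edge set is a linking for exactly one \<open>\<pi>\<close>, and the two
  minors are \<open>\<plusminus>1\<close> with relative sign \<open>(-1) ^ length a * sign \<pi>\<close>.
\<close>

lemma det_incidence_mat_mult_eq_linkings:
  assumes fs: "distinct fs" "set fs \<subseteq> edges G" "length fs = length a + length m"
    and len: "length a = length b"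
    and dist: "distinct (a @ b @ m @ d)" and verts: "set (a @ b @ m @ d) = verts G"
  shows "Determinant.det (incidence_mat (a @ m) fs) * Determinant.det (incidence_mat (b @ m) fs) =
    (-1) ^ length a * (\<Sum>\<pi> | \<pi> permutes {..<length a}.
      of_int (sign \<pi>) * of_bool (linking a b m d \<pi> (set fs)))"
proof -
  let ?F = "set fs"
  have Ra: "verts G - set (b @ m) = set a \<union> set d" and Rb: "verts G - set (a @ m) = set b \<union> set d"
    using dist unfolding verts[symmetric] by auto
  have card: "card ?F = length a + length m"
    using fs by (simp add: distinct_card)
  show ?thesis
  proof (cases "grounded ?F (set b \<union> set d) \<and> grounded ?F (set a \<union> set d)")
    case False
    then have "Determinant.det (incidence_mat (a @ m) fs) = 0 \<or> Determinant.det (incidence_mat (b @ m) fs) = 0"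
      using det_incidence_mat_eq_0[of fs "a @ m"] det_incidence_mat_eq_0[of fs "b @ m"] fs len dist Ra Rb
      by auto
    with False show ?thesis
      by (auto simp: linking_def)
  next
    case True
    have sq: "Determinant.det (incidence_mat (a @ m) fs) * Determinant.det (incidence_mat (a @ m) fs) = 1"
      "Determinant.det (incidence_mat (b @ m) fs) * Determinant.det (incidence_mat (b @ m) fs) = 1"
      using True fs len dist Ra Rb verts by (intro det_incidence_mat_squared; auto)+
    then have nz: "Determinant.det (incidence_mat (a @ m) fs) \<noteq> 0"
      "Determinant.det (incidence_mat (b @ m) fs) \<noteq> 0"
      by auto
    have sepb: "r = r'" if "r \<in> set b \<union> set d" "r' \<in> set b \<union> set d" "(r, r') \<in> connection G ?F" for r r'
      using roots_separated_if_det_nonzero[OF fs(1,2) _ nz(1), of r r'] that Rb fs(3) by auto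
    have sepa: "r = r'" if "r \<in> set a \<union> set d" "r' \<in> set a \<union> set d" "(r, r') \<in> connection G ?F" for r r'
      using roots_separated_if_det_nonzero[OF fs(1,2) _ nz(2), of r r'] that Ra fs(3) len by auto
    have "\<exists>j<length a. (a ! k, b ! j) \<in> connection G ?F" if k: "k < length a" for k
    proof -
      have "a ! k \<in> verts G"
        using k unfolding verts[symmetric] by simp
      then obtain r where r: "r \<in> set b \<union> set d" "(a ! k, r) \<in> connection G ?F"
        using True by (auto simp: grounded_def)
      have "r \<notin> set d"
      proof
        assume "r \<in> set d"
        then have "a ! k = r"
          using sepa[of "a ! k" r] r k by simp
        moreover have "a ! k \<in> set a" "set a \<inter> set d = {}"
          using k dist by auto
        ultimately show False
          using \<open>r \<in> set d\<close> by blast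
      qed
      then show ?thesis
        using r len by (auto simp: in_set_conv_nth)
    qed
    then obtain p where p: "\<And>k. k < length a \<Longrightarrow> p k < length a \<and> (a ! k, b ! p k) \<in> connection G ?F"
      by metis
    define \<rho> where "\<rho> k = (if k < length a then p k else k)" for k
    have link: "(a ! k, b ! \<rho> k) \<in> connection G ?F" if "k < length a" for k
      using p[OF that] that by (simp add: \<rho>_def)
    have "inj_on \<rho> {..<length a}"
    proof (rule inj_onI)
      fix k l
      assume kl: "k \<in> {..<length a}" "l \<in> {..<length a}" "\<rho> k = \<rho> l"
      then have "(a ! k, a ! l) \<in> connection G ?F"
        using link[of k] link[of l] connection_trans connection_sym by (metis lessThan_iff)
      then have "a ! k = a ! l"
        using sepa[of "a ! k" "a ! l"] kl by simp
      then show "k = l"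
        using kl dist by (simp add: nth_eq_iff_index_eq)
    qed
    moreover have "\<rho> ` {..<length a} \<subseteq> {..<length a}"
      using p by (auto simp: \<rho>_def)
    ultimately have "bij_betw \<rho> {..<length a} {..<length a}"
      by (simp add: bij_betw_def endo_inj_surj)
    then have \<rho>: "\<rho> permutes {..<length a}"
      by (rule bij_imp_permutes) (simp add: \<rho>_def)
    have unique: "linking a b m d \<pi> ?F \<longleftrightarrow> \<pi> = \<rho>" if \<pi>: "\<pi> permutes {..<length a}" for \<pi>
    proof
      assume l: "linking a b m d \<pi> ?F"
      show "\<pi> = \<rho>"
      proof
        fix k
        show "\<pi> k = \<rho> k"
        proof (cases "k < length a")
          case k: True
          have lt: "\<pi> k < length b" "\<rho> k < length b"
            using permutes_in_image[OF \<pi>, of k] permutes_in_image[OF \<rho>, of k] k len by auto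
          have "(b ! \<pi> k, b ! \<rho> k) \<in> connection G ?F"
            using l k link[OF k] connection_trans connection_sym unfolding linking_def by metis
          then have "b ! \<pi> k = b ! \<rho> k"
            using sepb[of "b ! \<pi> k" "b ! \<rho> k"] lt by simp
          then show ?thesis
            using lt dist by (simp add: nth_eq_iff_index_eq)
        qed (use \<pi> \<rho> in \<open>simp add: permutes_not_in\<close>)
      qed
    next
      assume "\<pi> = \<rho>"
      then show "linking a b m d \<pi> ?F"
        using True link fs card by (simp add: linking_def)
    qed
    have "(\<Sum>\<pi> | \<pi> permutes {..<length a}. of_int (sign \<pi>) * of_bool (linking a b m d \<pi> ?F)) =
        (\<Sum>\<pi> | \<pi> permutes {..<length a}. if \<pi> = \<rho> then of_int (sign \<rho>) else (0 :: real))"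
      using unique by (intro sum.cong) auto
    also have "\<dots> = of_int (sign \<rho>)"
      using \<rho> by (simp add: finite_permutations)
    finally show ?thesis
      using incidence_mat_change_roots[OF fs(2,3) len dist verts sepa sepb \<rho> link] sq(2)
      by (simp add: mult.assoc)
  qed
qed

text \<open>
  The negative of the usual graph Laplacian \<open>\<Sum>\<^sub>e c\<^sub>e x\<^sub>e x\<^sub>e\<^sup>T\<close>, so that it maps potentials to net
  currents with the sign convention of the response matrix.
\<close>

definition laplacian :: "'v \<Rightarrow> 'v \<Rightarrow> real" where
  "laplacian u v = (\<Sum>e\<in>edges G. - conductance G e * incidence e u * incidence e v)"

text \<open>
  Cauchy--Binet, with \<open>det_incidence_mat_mult_eq_linkings\<close> for each set of edges. Of the sign
  \<open>(-1) ^ (length a + length m)\<close> of the Laplacian, the part \<open>(-1) ^ length a\<close> cancels against the sign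
  of replacing \<open>a\<close> by \<open>b\<close>.
\<close>

theorem all_minors_matrix_tree:
  assumes len: "length a = length b"
    and dist: "distinct (a @ b @ m @ d)" and verts: "set (a @ b @ m @ d) = verts G"
  shows "Determinant.det (submatrix_of laplacian (a @ m) (b @ m)) =
    (-1) ^ length m * (\<Sum>\<pi> | \<pi> permutes {..<length a}.
      of_int (sign \<pi>) * (\<Sum>F | linking a b m d \<pi> F. grove_weight G F))"
proof -
  let ?n = "length a" and ?N = "length a + length m"
  obtain es where es: "distinct es" "set es = edges G"
    using finite_distinct_list[OF finite_edges] by blast
  let ?fs = "\<lambda>F. filter (\<lambda>e. e \<in> F) es"
  let ?P = "{F. F \<subseteq> edges G \<and> card F = ?N}"
  have inner: "(\<Sum>F\<in>?P. of_bool (linking a b m d \<pi> F) * grove_weight G F) =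
      (\<Sum>F | linking a b m d \<pi> F. grove_weight G F)" for \<pi>
  proof -
    have "finite ?P"
      using finite_edges by simp
    then show ?thesis
      by (intro sum.mono_neutral_cong_right) (auto simp: linking_def)
  qed
  have lap: "laplacian u v = (\<Sum>e\<leftarrow>es. - conductance G e * incidence e u * incidence e v)" for u v
    unfolding laplacian_def es(2)[symmetric] by (rule sum_list_distinct_conv_sum_set[OF es(1), symmetric])
  have "Determinant.det (submatrix_of laplacian (a @ m) (b @ m)) =
      Determinant.det (mat ?N ?N (\<lambda>(i, j).
        \<Sum>e\<leftarrow>es. - conductance G e * incidence e ((a @ m) ! i) * incidence e ((b @ m) ! j)))"
    using len by (simp add: submatrix_of_def lap)
  also have "\<dots> = (\<Sum>F\<in>?P. (\<Prod>e\<in>F. - conductance G e) *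
      Determinant.det (mat ?N ?N (\<lambda>(i, j). incidence (?fs F ! j) ((a @ m) ! i))) *
      Determinant.det (mat ?N ?N (\<lambda>(i, j). incidence (?fs F ! j) ((b @ m) ! i))))"
    unfolding es(2)[symmetric] by (rule cauchy_binet[OF es(1)])
  also have "\<dots> = (\<Sum>F\<in>?P. (-1) ^ length m * (\<Sum>\<pi> | \<pi> permutes {..<?n}.
      of_int (sign \<pi>) * (of_bool (linking a b m d \<pi> F) * grove_weight G F)))"
  proof (rule sum.cong[OF refl])
    fix F
    assume F: "F \<in> ?P"
    then have set: "set (?fs F) = F"
      using es by auto
    have fs1: "distinct (?fs F)"
      using es(1) by simp
    have "length (?fs F) = card F"
      using distinct_card[OF fs1] unfolding set by simp
    then have fs: "distinct (?fs F)" "length (?fs F) = ?N"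
      using fs1 F by simp_all
    have "Determinant.det (mat ?N ?N (\<lambda>(i, j). incidence (?fs F ! j) ((a @ m) ! i))) *
        Determinant.det (mat ?N ?N (\<lambda>(i, j). incidence (?fs F ! j) ((b @ m) ! i))) =
        (-1) ^ ?n * (\<Sum>\<pi> | \<pi> permutes {..<?n}. of_int (sign \<pi>) * of_bool (linking a b m d \<pi> F))"
      using det_incidence_mat_mult_eq_linkings[OF fs(1) _ fs(2) len dist verts] F
      unfolding set by (simp add: incidence_mat_def len)
    moreover have "(\<Prod>e\<in>F. - conductance G e) = (-1) ^ ?N * grove_weight G F"
      using F by (simp add: prod_uminus grove_weight_def)
    ultimately have "(\<Prod>e\<in>F. - conductance G e) *
        Determinant.det (mat ?N ?N (\<lambda>(i, j). incidence (?fs F ! j) ((a @ m) ! i))) *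
        Determinant.det (mat ?N ?N (\<lambda>(i, j). incidence (?fs F ! j) ((b @ m) ! i))) =
        (-1) ^ ?N * (-1) ^ ?n * (grove_weight G F *
          (\<Sum>\<pi> | \<pi> permutes {..<?n}. of_int (sign \<pi>) * of_bool (linking a b m d \<pi> F)))"
      by (simp only: mult.assoc mult.left_commute)
    also have "(-1) ^ ?N * (-1) ^ ?n = ((-1) ^ length m :: real)"
      by (simp add: power_add)
    finally show "(\<Prod>e\<in>F. - conductance G e) *
        Determinant.det (mat ?N ?N (\<lambda>(i, j). incidence (?fs F ! j) ((a @ m) ! i))) *
        Determinant.det (mat ?N ?N (\<lambda>(i, j). incidence (?fs F ! j) ((b @ m) ! i))) =
        (-1) ^ length m * (\<Sum>\<pi> | \<pi> permutes {..<?n}.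
          of_int (sign \<pi>) * (of_bool (linking a b m d \<pi> F) * grove_weight G F))"
      by (simp add: sum_distrib_left mult_ac)
  qed
  also have "\<dots> = (-1) ^ length m * (\<Sum>\<pi> | \<pi> permutes {..<?n}.
      of_int (sign \<pi>) * (\<Sum>F\<in>?P. of_bool (linking a b m d \<pi> F) * grove_weight G F))"
    by (simp only: sum_distrib_left[symmetric] sum.swap[of _ "{\<pi>. \<pi> permutes {..<?n}}" ?P])
  finally show ?thesis
    by (simp only: inner)
qed

lemma net_current_laplacian:
  assumes u: "u \<in> verts G"
  shows "net_current G V u = (\<Sum>v\<in>verts G. laplacian u v * V v)"
proof -
  have "net_current G V u =
      (\<Sum>w\<in>verts G. \<Sum>e\<in>edges G. if ends G e = {u, w} then conductance G e * (V w - V u) else 0)"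
    unfolding net_current_def using finite_edges by (intro sum.cong sum.inter_filter) auto
  also have "\<dots> = (\<Sum>e\<in>edges G. \<Sum>w\<in>verts G. if ends G e = {u, w} then conductance G e * (V w - V u) else 0)"
    by (rule sum.swap)
  also have "\<dots> = (\<Sum>e\<in>edges G. \<Sum>v\<in>verts G. - conductance G e * incidence e u * incidence e v * V v)"
  proof (rule sum.cong[OF refl])
    fix e
    assume e: "e \<in> edges G"
    define s t where "s = fst (orientation e)" and "t = snd (orientation e)"
    have st: "s \<in> verts G" "t \<in> verts G" "ends G e = {s, t}"
      using orientation[OF e] by (simp_all add: s_def t_def)
    have "(\<Sum>v\<in>verts G. incidence e v * V v) =
        (\<Sum>v\<in>verts G. (if v = s then V s else 0) - (if v = t then V t else 0))"
      by (intro sum.cong) (auto simp: incidence_def s_def t_def)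
    also have "\<dots> = V s - V t"
      using st finite_verts by (simp add: sum_subtractf)
    finally have V: "(\<Sum>v\<in>verts G. incidence e v * V v) = V s - V t" .
    have "(\<Sum>v\<in>verts G. - conductance G e * incidence e u * incidence e v * V v) =
        - conductance G e * incidence e u * (V s - V t)"
      unfolding V[symmetric] sum_distrib_left by (simp add: mult.assoc)
    moreover have "(\<Sum>w\<in>verts G. if ends G e = {u, w} then conductance G e * (V w - V u) else 0) =
        (\<Sum>w\<in>verts G. if w = (if u = s then t else s) then
          if u = s \<or> u = t then conductance G e * (V w - V u) else 0 else 0)"
      unfolding st(3) by (intro sum.cong) (auto simp: doubleton_eq_iff)
    moreover have "\<dots> = - conductance G e * incidence e u * (V s - V t)"
      using st(1,2) finite_verts
      by (auto simp: incidence_def algebra_simps simp flip: s_def t_def)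
    ultimately show "(\<Sum>w\<in>verts G. if ends G e = {u, w} then conductance G e * (V w - V u) else 0) =
        (\<Sum>v\<in>verts G. - conductance G e * incidence e u * incidence e v * V v)"
      by simp
  qed
  also have "\<dots> = (\<Sum>v\<in>verts G. laplacian u v * V v)"
    unfolding laplacian_def sum_distrib_right by (rule sum.swap)
  finally show ?thesis .
qed

end

section \<open>The response matrix as a Schur complement\<close>

context finite_network
begin

lemma grove_connects_to_node:
  assumes F: "F \<in> groves G" and v: "v \<in> verts G"
  obtains w where "w \<in> nodes G" "(v, w) \<in> connection G F"
proof -
  have "connection G F `` {v} \<inter> nodes G \<noteq> {}"
    using F quotientI[OF v, of "connection G F"] by (auto simp: groves_def)
  then show thesis
    using that by auto
qed

text \<open>
  A potential that vanishes at the nodes and is harmonic elsewhere dissipates no energy. So it is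
  constant along edges, hence 0 because a grove connects every vertex to a node.
\<close>

lemma det_interior_laplacian_nonzero:
  assumes ne: "groves G \<noteq> {}" and ints: "distinct ints" "set ints = verts G - nodes G"
  shows "Determinant.det (submatrix_of laplacian ints ints) \<noteq> 0"
proof
  let ?I = "length ints" and ?N = "submatrix_of laplacian ints ints"
  assume "Determinant.det ?N = 0"
  moreover have N: "?N \<in> carrier_mat ?I ?I"
    by (simp add: submatrix_of_def)
  ultimately obtain t where t: "t \<in> carrier_vec ?I" "t \<noteq> 0\<^sub>v ?I" "?N *\<^sub>v t = 0\<^sub>v ?I"
    using det_0_iff_vec_prod_zero[OF N] by blast
  define V where "V v = (if v \<in> set ints then t $ (SOME l. l < ?I \<and> ints ! l = v) else 0)" for v
  have V: "V (ints ! l) = t $ l" if l: "l < ?I" for l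
  proof -
    have "(SOME l'. l' < ?I \<and> ints ! l' = ints ! l) = l"
      using l ints(1) by (intro some_equality) (auto simp: nth_eq_iff_index_eq)
    then show ?thesis
      using l by (simp add: V_def)
  qed
  have V0: "V v = 0" if "v \<in> nodes G" for v
    using that ints(2) by (simp add: V_def)
  have harm: "(\<Sum>v\<in>verts G. laplacian u v * V v) = 0" if u: "u \<in> verts G - nodes G" for u
  proof -
    obtain k where k: "k < ?I" "ints ! k = u"
      using u ints(2) by (metis in_set_conv_nth)
    have "(\<Sum>v\<in>verts G. laplacian u v * V v) = (\<Sum>v\<in>set ints. laplacian u v * V v)"
      unfolding ints(2) using finite_verts V0 by (intro sum.mono_neutral_right) auto
    also have "\<dots> = (\<Sum>l<?I. laplacian u (ints ! l) * V (ints ! l))"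
      by (rule sum_nth_distinct[OF ints(1), symmetric])
    also have "\<dots> = (?N *\<^sub>v t) $ k"
      using k t(1) by (auto simp: submatrix_of_def scalar_prod_def atLeast0LessThan V)
    also have "\<dots> = 0"
      using t(3) k by simp
    finally show ?thesis .
  qed
  define drop where "drop e = (\<Sum>u\<in>verts G. incidence e u * V u)" for e
  \<comment> \<open>The energy is also minus the sum of \<open>V u\<close> times the net current at \<open>u\<close>, and in each of
    these products one factor is 0.\<close>
  have "(\<Sum>e\<in>edges G. conductance G e * (drop e)\<^sup>2) =
      (\<Sum>e\<in>edges G. \<Sum>u\<in>verts G. \<Sum>v\<in>verts G.
        - (V u * (- conductance G e * incidence e u * incidence e v * V v)))"
    unfolding drop_def power2_eq_square sum_product unfolding sum_distrib_left
    by (intro sum.cong) (auto simp: mult_ac)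
  also have "\<dots> = (\<Sum>u\<in>verts G. \<Sum>v\<in>verts G. \<Sum>e\<in>edges G.
        - (V u * (- conductance G e * incidence e u * incidence e v * V v)))"
    by (subst sum.swap, rule sum.cong[OF refl], rule sum.swap)
  also have "\<dots> = (\<Sum>u\<in>verts G. - (V u * (\<Sum>v\<in>verts G. laplacian u v * V v)))"
    by (simp only: laplacian_def sum_distrib_left sum_distrib_right sum_negf)
  also have "\<dots> = 0"
    using harm V0 by (intro sum.neutral) auto
  finally have "(\<Sum>e\<in>edges G. conductance G e * (drop e)\<^sup>2) = 0" .
  moreover have "0 \<le> conductance G e * (drop e)\<^sup>2" if "e \<in> edges G" for e
    using conductance_pos[OF that] by simp
  ultimately have "\<forall>e\<in>edges G. conductance G e * (drop e)\<^sup>2 = 0"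
    using sum_nonneg_eq_0_iff[OF finite_edges, of "\<lambda>e. conductance G e * (drop e)\<^sup>2"] by blast
  then have drop: "drop e = 0" if "e \<in> edges G" for e
    using that conductance_pos[OF that] by auto
  have edge: "V w = V w'" if e: "e \<in> edges G" "ends G e = {w, w'}" for e w w'
  proof -
    obtain s where s: "s * s = 1" "\<And>v. s * incidence e v = of_bool (v = w) - of_bool (v = w')"
      using incidence_ends[OF e] by blast
    have ww: "w \<in> verts G" "w' \<in> verts G"
      using orientation[OF e(1)] e(2) by (metis insert_iff singletonD)+
    have "0 = s * drop e"
      using drop e by simp
    also have "\<dots> = (\<Sum>v\<in>verts G. (of_bool (v = w) - of_bool (v = w')) * V v)"
      by (simp add: drop_def sum_distrib_left s(2)[symmetric] mult.assoc)
    also have "\<dots> = (\<Sum>v\<in>verts G. (if v = w then V w else 0) - (if v = w' then V w' else 0))"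
      by (intro sum.cong) auto
    also have "\<dots> = V w - V w'"
      using ww finite_verts by (simp add: sum_subtractf)
    finally show ?thesis
      by simp
  qed
  obtain F where F: "F \<in> groves G"
    using ne by blast
  have FE: "F \<subseteq> edges G"
    using F by (auto simp: groves_def spanning_forest_def)
  have const: "V v = V w" if "(v, w) \<in> connection G F" for v w
    using that
  proof (induction rule: connection_induct)
    case (step w w' e)
    then show ?case
      using edge[of e w w'] FE by auto
  qed simp
  have "V v = 0" if "v \<in> verts G" for v
  proof -
    obtain w where "w \<in> nodes G" "(v, w) \<in> connection G F"
      using grove_connects_to_node[OF F \<open>v \<in> verts G\<close>] .
    then show ?thesis
      using const V0 by simp
  qed
  moreover have "ints ! l \<in> verts G" if "l < ?I" for l
    using nth_mem[OF that] ints(2) by auto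
  ultimately have "t $ l = 0" if "l < ?I" for l
    using V[OF that] that by simp
  then have "t = 0\<^sub>v ?I"
    using t(1) by (intro eq_vecI) auto
  with t(2) show False ..
qed

text \<open>
  Harmonicity is a linear system for the interior values, whose matrix is the interior Laplacian.
\<close>

lemma harmonic_extension_exists:
  assumes ne: "groves G \<noteq> {}"
  shows "\<exists>V. harmonic_extension G v V"
proof -
  obtain ints where ints: "distinct ints" "set ints = verts G - nodes G"
    using finite_distinct_list[of "verts G - nodes G"] finite_verts by auto
  let ?I = "length ints" and ?N = "submatrix_of laplacian ints ints"
  have N: "?N \<in> carrier_mat ?I ?I"
    by (simp add: submatrix_of_def)
  obtain B where B: "B \<in> carrier_mat ?I ?I" "?N * B = 1\<^sub>m ?I"
    using det_non_zero_imp_unit[OF N det_interior_laplacian_nonzero[OF ne ints], of "()"]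
    by (auto simp: Units_def ring_mat_def)
  define r where "r = vec ?I (\<lambda>k. - (\<Sum>j\<in>nodes G. laplacian (ints ! k) j * v j))"
  have r: "r \<in> carrier_vec ?I"
    by (simp add: r_def)
  define x where "x = B *\<^sub>v r"
  have x: "x \<in> carrier_vec ?I" "?N *\<^sub>v x = r"
    using B r by (simp_all add: x_def flip: assoc_mult_mat_vec[OF N B(1) r])
  define V where "V u = (if u \<in> set ints then x $ (SOME l. l < ?I \<and> ints ! l = u) else v u)" for u
  have V: "V (ints ! l) = x $ l" if l: "l < ?I" for l
  proof -
    have "(SOME l'. l' < ?I \<and> ints ! l' = ints ! l) = l"
      using l ints(1) by (intro some_equality) (auto simp: nth_eq_iff_index_eq)
    then show ?thesis
      using l by (simp add: V_def)
  qed
  have Vn: "V j = v j" if "j \<in> nodes G" for j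
    using that ints(2) by (simp add: V_def)
  have "net_current G V u = 0" if u: "u \<in> verts G - nodes G" for u
  proof -
    obtain k where k: "k < ?I" "ints ! k = u"
      using u ints(2) by (metis in_set_conv_nth)
    have "net_current G V u = (\<Sum>w\<in>verts G. laplacian u w * V w)"
      using u by (intro net_current_laplacian) auto
    also have "\<dots> = (\<Sum>w\<in>set ints. laplacian u w * V w) + (\<Sum>w\<in>nodes G. laplacian u w * V w)"
      unfolding ints(2) using sum.subset_diff[OF nodes_subset finite_verts] by blast
    also have "(\<Sum>w\<in>set ints. laplacian u w * V w) = (\<Sum>l<?I. laplacian u (ints ! l) * V (ints ! l))"
      by (rule sum_nth_distinct[OF ints(1), symmetric])
    also have "\<dots> = (?N *\<^sub>v x) $ k"
      using k x(1) by (auto simp: submatrix_of_def scalar_prod_def atLeast0LessThan V)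
    also have "\<dots> = - (\<Sum>j\<in>nodes G. laplacian u j * v j)"
      using x(2) k by (simp add: r_def)
    finally show ?thesis
      by (simp add: Vn)
  qed
  then show ?thesis
    using Vn by (auto simp: harmonic_extension_def)
qed

text \<open>
  The response matrix is the Schur complement of the interior block in the Laplacian. In the Laplacian
  minor, adding the interior columns with the coefficients of the harmonic extension to the node columns
  turns the latter into the net currents of that extension: the response matrix in the node rows,
  and 0 in the interior rows.
\<close>

lemma det_response_minor:
  assumes ne: "groves G \<noteq> {}" and ints: "distinct ints" "set ints = verts G - nodes G"
    and len: "length rs = length cs" and sub: "set rs \<subseteq> nodes G" "set cs \<subseteq> nodes G"
  shows "Determinant.det (submatrix_of laplacian (rs @ ints) (cs @ ints)) =
    Determinant.det (submatrix_of (response_matrix G) rs cs) *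
    Determinant.det (submatrix_of laplacian ints ints)"
proof -
  let ?n = "length rs" and ?I = "length ints"
  let ?m = "?n + ?I"
  define V where "V j = (SOME V. harmonic_extension G (\<lambda>k. if k = j then 1 else 0) V)" for j
  have V: "harmonic_extension G (\<lambda>k. if k = j then 1 else 0) (V j)" for j
    unfolding V_def by (rule someI_ex[OF harmonic_extension_exists[OF ne]])
  have net: "net_current G (V j) u = laplacian u j + (\<Sum>k<?I. laplacian u (ints ! k) * V j (ints ! k))"
    if u: "u \<in> verts G" and j: "j \<in> nodes G" for u j
  proof -
    have "net_current G (V j) u = (\<Sum>w\<in>set ints. laplacian u w * V j w) + (\<Sum>w\<in>nodes G. laplacian u w * V j w)"
      unfolding net_current_laplacian[OF u] ints(2)
      using sum.subset_diff[OF nodes_subset finite_verts] by blast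
    moreover have "(\<Sum>w\<in>nodes G. laplacian u w * V j w) = (\<Sum>w\<in>nodes G. if w = j then laplacian u j else 0)"
      using V[of j] by (intro sum.cong) (auto simp: harmonic_extension_def)
    moreover have "\<dots> = laplacian u j"
      using j finite_subset[OF nodes_subset finite_verts] by simp
    ultimately show ?thesis
      by (simp add: sum_nth_distinct[OF ints(1), of "\<lambda>w. laplacian u w * V j w"])
  qed
  define M where "M = submatrix_of laplacian (rs @ ints) (cs @ ints)"
  \<comment> \<open>The column operations: the lower left block contains the interior values of the harmonic extensions.\<close>
  define H where "H = mat ?m ?m (\<lambda>(i, j). if i = j then 1
    else if j < ?n \<and> ?n \<le> i then V (cs ! j) (ints ! (i - ?n)) else 0)"
  define L where "L = submatrix_of (response_matrix G) rs cs"
  define N where "N = submatrix_of laplacian ints ints"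
  define W where "W = submatrix_of laplacian rs ints"
  have M: "M \<in> carrier_mat ?m ?m" and H: "H \<in> carrier_mat ?m ?m"
    and L: "L \<in> carrier_mat ?n ?n" and N: "N \<in> carrier_mat ?I ?I" and W: "W \<in> carrier_mat ?n ?I"
    using len by (simp_all add: M_def H_def L_def N_def W_def submatrix_of_def)
  have "Determinant.det H = prod_list (diag_mat H)"
    by (rule det_lower_triangular[OF _ H]) (auto simp: H_def)
  also have "diag_mat H = replicate ?m 1"
    by (rule nth_equalityI) (auto simp: diag_mat_def H_def)
  finally have detH: "Determinant.det H = 1"
    by (simp add: prod_list_replicate)
  have "M * H = four_block_mat L W (0\<^sub>m ?I ?n) N"
  proof (rule eq_matI)
    fix i j
    assume "i < dim_row (four_block_mat L W (0\<^sub>m ?I ?n) N)" "j < dim_col (four_block_mat L W (0\<^sub>m ?I ?n) N)"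
    then have ij: "i < ?m" "j < ?m"
      using L N by auto
    let ?u = "(rs @ ints) ! i"
    have u: "?u \<in> verts G \<and> (?n \<le> i \<longrightarrow> ?u \<notin> nodes G)"
    proof (cases "i < ?n")
      case True
      have "rs ! i \<in> verts G"
        by (rule subsetD[OF subset_trans[OF sub(1) nodes_subset] nth_mem[OF True]])
      with True show ?thesis
        by (simp add: nth_append)
    next
      case False
      then have "ints ! (i - ?n) \<in> set ints"
        using ij by (intro nth_mem) auto
      with False ints(2) show ?thesis
        by (simp add: nth_append)
    qed
    have "(M * H) $$ (i, j) = (\<Sum>r<?m. M $$ (i, r) * H $$ (r, j))"
      by (rule index_mult_mat_sum[OF M H ij])
    also have "\<dots> = (\<Sum>r<?n. M $$ (i, r) * H $$ (r, j)) + (\<Sum>r<?I. M $$ (i, ?n + r) * H $$ (?n + r, j))"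
      by (rule sum_lessThan_add)
    also have "(\<Sum>r<?n. M $$ (i, r) * H $$ (r, j)) = (\<Sum>r<?n. if r = j then laplacian ?u (cs ! j) else 0)"
      using ij len by (intro sum.cong) (auto simp: M_def H_def submatrix_of_def nth_append)
    also have "(\<Sum>r<?I. M $$ (i, ?n + r) * H $$ (?n + r, j)) = (\<Sum>r<?I. laplacian ?u (ints ! r) *
        (if ?n + r = j then 1 else if j < ?n then V (cs ! j) (ints ! r) else 0))"
      using ij len by (intro sum.cong) (auto simp: M_def H_def submatrix_of_def nth_append)
    finally have MH: "(M * H) $$ (i, j) = (if j < ?n then laplacian ?u (cs ! j) else 0) +
        (\<Sum>r<?I. laplacian ?u (ints ! r) *
          (if ?n + r = j then 1 else if j < ?n then V (cs ! j) (ints ! r) else 0))"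
      by simp
    show "(M * H) $$ (i, j) = four_block_mat L W (0\<^sub>m ?I ?n) N $$ (i, j)"
    proof (cases "j < ?n")
      case True
      have cj: "cs ! j \<in> nodes G"
        using True len sub(2) by auto
      have "(\<Sum>r<?I. laplacian ?u (ints ! r) *
          (if ?n + r = j then 1 else if j < ?n then V (cs ! j) (ints ! r) else 0)) =
          (\<Sum>r<?I. laplacian ?u (ints ! r) * V (cs ! j) (ints ! r))"
        using True by (intro sum.cong) auto
      then have "(M * H) $$ (i, j) = net_current G (V (cs ! j)) ?u"
        using True by (simp add: MH net[OF conjunct1[OF u] cj])
      also have "\<dots> = (if i < ?n then response_matrix G (rs ! i) (cs ! j) else 0)"
      proof (cases "i < ?n")
        case True
        then show ?thesis
          by (simp add: nth_append response_matrix_def response_def V_def)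
      next
        case False
        then have "?u \<in> verts G - nodes G"
          using u by simp
        with False show ?thesis
          using V[of "cs ! j"] unfolding harmonic_extension_def by simp
      qed
      finally show ?thesis
        using True ij len by (auto simp: L_def W_def N_def submatrix_of_def)
    next
      case False
      have "(\<Sum>r<?I. laplacian ?u (ints ! r) *
          (if ?n + r = j then 1 else if j < ?n then V (cs ! j) (ints ! r) else 0)) =
          (\<Sum>r<?I. if r = j - ?n then laplacian ?u (ints ! r) else 0)"
        using False by (intro sum.cong) auto
      then have "(M * H) $$ (i, j) = laplacian ?u (ints ! (j - ?n))"
        using False ij by (auto simp: MH)
      then show ?thesis
        using False ij len by (auto simp: L_def W_def N_def submatrix_of_def nth_append)
    qed
  qed (use M H L N in auto)
  then have "Determinant.det M = Determinant.det (four_block_mat L W (0\<^sub>m ?I ?n) N)"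
    using det_mult[OF M H] detH by simp
  also have "\<dots> = Determinant.det L * Determinant.det N"
    by (rule det_four_block_mat_lower_left_zero[OF L W refl N])
  finally show ?thesis
    by (simp add: M_def L_def N_def)
qed

end

section \<open>Node partitions of groves\<close>

text \<open>
  The classes of \<open>R\<close> arise by inserting \<open>C\<close> into the parts of \<open>Q\<close> if and only if the parts of \<open>Q\<close> are the traces
  of the classes on \<open>\<Union>Q\<close>. The function that witnesses the insertion sends \<open>x\<close> to the part it is related
  to. In this form the condition can be compared with \<open>linking\<close>.
\<close>

lemma quotient_in_insertions_iff:
  assumes R: "equiv (\<Union>Q \<union> C) R" and Q: "{} \<notin> Q" and disj: "\<Union>Q \<inter> C = {}"
  shows "(\<Union>Q \<union> C) // R \<in> insertions Q C \<longleftrightarrow>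
    (\<forall>S\<in>Q. \<forall>x\<in>S. \<forall>y\<in>S. (x, y) \<in> R) \<and>
    (\<forall>S\<in>Q. \<forall>S'\<in>Q. \<forall>x\<in>S. \<forall>y\<in>S'. (x, y) \<in> R \<longrightarrow> S = S') \<and>
    (\<forall>x\<in>\<Union>Q \<union> C. \<exists>S\<in>Q. \<exists>s\<in>S. (x, s) \<in> R)"
    (is "?N // R \<in> _ \<longleftrightarrow> ?together \<and> ?apart \<and> ?covered")
proof
  assume "?N // R \<in> insertions Q C"
  then obtain f where NR: "?N // R = {S \<union> {x \<in> C. f x = S} |S. S \<in> Q}"
    by (auto simp: insertions_def)
  let ?P = "\<lambda>S. S \<union> {x \<in> C. f x = S}"
  have part: "?P S \<in> ?N // R" if "S \<in> Q" for S
    unfolding NR using that by blast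
  have 1: ?together
  proof safe
    fix S x y
    assume "S \<in> Q" "x \<in> S" "y \<in> S"
    then show "(x, y) \<in> R"
      using quotient_eq_iff[OF R part part, of S S x y] by simp
  qed
  have 2: ?apart
  proof safe
    fix S S' x y z
    assume S: "S \<in> Q" "S' \<in> Q" "x \<in> S" "y \<in> S'" "(x, y) \<in> R"
    then have "?P S = ?P S'"
      using quotient_eq_iff[OF R part part, of S S' x y] by simp
    moreover have "S \<inter> C = {}" "S' \<inter> C = {}"
      using S disj by auto
    ultimately show "z \<in> S \<Longrightarrow> z \<in> S'" "z \<in> S' \<Longrightarrow> z \<in> S"
      by blast+
  qed
  have 3: ?covered
  proof
    fix x
    assume x: "x \<in> ?N"
    then have "R `` {x} \<in> ?N // R"
      by (rule quotientI)
    then obtain S where S: "S \<in> Q" "R `` {x} = ?P S"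
      unfolding NR by blast
    then obtain s where "s \<in> S"
      using Q by (metis ex_in_conv)
    with S show "\<exists>S\<in>Q. \<exists>s\<in>S. (x, s) \<in> R"
      by blast
  qed
  from 1 2 3 show "?together \<and> ?apart \<and> ?covered"
    by (intro conjI)
next
  assume h: "?together \<and> ?apart \<and> ?covered"
  have together: "(x, y) \<in> R" if "S \<in> Q" "x \<in> S" "y \<in> S" for S x y
    using conjunct1[OF h] that by blast
  have apart: "S = S'" if "S \<in> Q" "S' \<in> Q" "x \<in> S" "y \<in> S'" "(x, y) \<in> R" for S S' x y
    using conjunct1[OF conjunct2[OF h]] that by blast
  have covered: "\<exists>S\<in>Q. \<exists>s\<in>S. (x, s) \<in> R" if "x \<in> ?N" for x
    using conjunct2[OF conjunct2[OF h]] that by blast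
  have "sym R" "trans R" "R \<subseteq> ?N \<times> ?N"
    using R by (simp_all add: equiv_def)
  then have sym: "(x, y) \<in> R \<Longrightarrow> (y, x) \<in> R"
    and trans: "(x, y) \<in> R \<Longrightarrow> (y, z) \<in> R \<Longrightarrow> (x, z) \<in> R"
    and RN: "(x, y) \<in> R \<Longrightarrow> y \<in> ?N" for x y z
    by (blast dest: symD, blast dest: transD, blast)
  have "\<forall>x\<in>C. \<exists>S. S \<in> Q \<and> (\<exists>s\<in>S. (x, s) \<in> R)"
    using covered by blast
  then obtain f where f: "\<And>x. x \<in> C \<Longrightarrow> f x \<in> Q \<and> (\<exists>s\<in>f x. (x, s) \<in> R)"
    by metis
  have cls: "R `` {s} = S \<union> {x \<in> C. f x = S}" if S: "S \<in> Q" "s \<in> S" for s S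
  proof (intro equalityI subsetI)
    fix y
    assume "y \<in> R `` {s}"
    then have sy: "(s, y) \<in> R"
      by simp
    show "y \<in> S \<union> {x \<in> C. f x = S}"
    proof (cases "y \<in> C")
      case True
      then obtain s' where "s' \<in> f y" "(y, s') \<in> R"
        using f by blast
      then have "S = f y"
        using apart[of S "f y" s s'] S f[OF True] trans[OF sy] by blast
      with True show ?thesis
        by simp
    next
      case False
      then obtain S' where "S' \<in> Q" "y \<in> S'"
        using RN[OF sy] by blast
      then show ?thesis
        using apart[of S S' s y] S sy by blast
    qed
  next
    fix y
    assume "y \<in> S \<union> {x \<in> C. f x = S}"
    then consider "y \<in> S" | "y \<in> C" "f y = S"
      by blast
    then show "y \<in> R `` {s}"
    proof cases
      case 1
      then show ?thesis
        using together S by blast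
    next
      case 2
      then obtain s' where "s' \<in> S" "(y, s') \<in> R"
        using f by blast
      then show ?thesis
        using trans[OF together[OF S(1) S(2)] sym] by blast
    qed
  qed
  have "?N // R = {S \<union> {x \<in> C. f x = S} |S. S \<in> Q}"
  proof (intro equalityI subsetI)
    fix P
    assume "P \<in> ?N // R"
    then obtain x where x: "x \<in> ?N" "P = R `` {x}"
      by (rule quotientE)
    then obtain S s where S: "S \<in> Q" "s \<in> S" "(x, s) \<in> R"
      using covered by blast
    then have "P = R `` {s}"
      using equiv_class_eq[OF R] x by blast
    then show "P \<in> {S \<union> {x \<in> C. f x = S} |S. S \<in> Q}"
      using cls S by blast
  next
    fix P
    assume "P \<in> {S \<union> {x \<in> C. f x = S} |S. S \<in> Q}"
    then obtain S where S: "S \<in> Q" "P = S \<union> {x \<in> C. f x = S}"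
      by blast
    then obtain s where s: "s \<in> S"
      using Q by (metis ex_in_conv)
    then have "P = R `` {s}" "s \<in> ?N"
      using cls S by auto
    then show "P \<in> ?N // R"
      by (metis quotientI)
  qed
  then show "?N // R \<in> insertions Q C"
    using f by (auto simp: insertions_def)
qed

text \<open>
  Each part has exactly one element in \<open>a @ d\<close> and one in \<open>b @ d\<close>, which are the two sets of vertices whose
  rows or columns are deleted.
\<close>

lemma displayed_partition_parts:
  assumes len: "length a = length b" and dist: "distinct (a @ b @ d)"
    and \<pi>: "\<pi> permutes {..<length a}"
  shows "\<Union>(displayed_partition a b d \<pi>) = set a \<union> set b \<union> set d"
    and "S \<in> displayed_partition a b d \<pi> \<Longrightarrow> \<exists>r. S \<inter> (set a \<union> set d) = {r}"
    and "S \<in> displayed_partition a b d \<pi> \<Longrightarrow> \<exists>r. S \<inter> (set b \<union> set d) = {r}"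
    and "S \<in> displayed_partition a b d \<pi> \<Longrightarrow> S' \<in> displayed_partition a b d \<pi> \<Longrightarrow>
      x \<in> S \<Longrightarrow> x \<in> S' \<Longrightarrow> S = S'"
proof -
  let ?Q = "displayed_partition a b d \<pi>" and ?n = "length a"
  have lt: "\<pi> k < length b" if "k < ?n" for k
    using permutes_in_image[OF \<pi>, of k] that len by simp
  have mem: "a ! k \<in> set a" "b ! \<pi> k \<in> set b" if "k < ?n" for k
    using that lt by auto
  have disj: "set a \<inter> set b = {}" "set a \<inter> set d = {}" "set b \<inter> set d = {}" "distinct a" "distinct b"
    using dist by auto
  have cases: "(\<exists>k<?n. S = {a ! k, b ! \<pi> k}) \<or> (\<exists>x\<in>set d. S = {x})" if "S \<in> ?Q" for S
    using that by (auto simp: displayed_partition_def)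
  have "\<exists>k<?n. x = b ! \<pi> k" if x: "x \<in> set b" for x
  proof -
    obtain j where j: "j < length b" "b ! j = x"
      using x by (auto simp: in_set_conv_nth)
    then have "j \<in> \<pi> ` {..<?n}"
      using permutes_image[OF \<pi>] len by simp
    then obtain k where "k < ?n" "j = \<pi> k"
      by auto
    with j(2) show ?thesis
      by auto
  qed
  moreover have "\<exists>k<?n. x = a ! k" if x: "x \<in> set a" for x
    using x by (metis in_set_conv_nth)
  moreover have "{a ! k, b ! \<pi> k} \<in> ?Q" if "k < ?n" for k
    using that by (auto simp: displayed_partition_def)
  ultimately have "set b \<subseteq> \<Union>?Q" "set a \<subseteq> \<Union>?Q"
    by blast+
  moreover have "set d \<subseteq> \<Union>?Q"
    by (auto simp: displayed_partition_def)
  moreover have "S \<subseteq> set a \<union> set b \<union> set d" if "S \<in> ?Q" for S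
    using cases[OF that] mem by blast
  ultimately show "\<Union>?Q = set a \<union> set b \<union> set d"
    by blast
  show "\<exists>r. S \<inter> (set a \<union> set d) = {r}" if "S \<in> ?Q"
    using cases[OF that]
  proof (elim disjE exE bexE conjE)
    fix k
    assume k: "k < ?n" "S = {a ! k, b ! \<pi> k}"
    have "S \<inter> (set a \<union> set d) = {a ! k}"
      unfolding k(2) using mem[OF k(1)] disj(1,3) by blast
    then show ?thesis ..
  qed auto
  show "\<exists>r. S \<inter> (set b \<union> set d) = {r}" if "S \<in> ?Q"
    using cases[OF that]
  proof (elim disjE exE bexE conjE)
    fix k
    assume k: "k < ?n" "S = {a ! k, b ! \<pi> k}"
    have "S \<inter> (set b \<union> set d) = {b ! \<pi> k}"
      unfolding k(2) using mem[OF k(1)] disj(1,2) by blast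
    then show ?thesis ..
  qed auto
  show "S = S'" if S: "S \<in> ?Q" "S' \<in> ?Q" "x \<in> S" "x \<in> S'"
  proof -
    have ad: "a ! k \<notin> set d" "b ! \<pi> k \<notin> set d" if "k < ?n" for k
      using mem[OF that] disj(2,3) by (metis disjoint_iff)+
    have ab: "a ! k \<noteq> b ! \<pi> l" if "k < ?n" "l < ?n" for k l
      using mem(1)[OF that(1)] mem(2)[OF that(2)] disj(1) by (metis disjoint_iff)
    have eq: "k = l" if "k < ?n" "l < ?n" "x \<in> {a ! k, b ! \<pi> k}" "x \<in> {a ! l, b ! \<pi> l}" for k l
    proof -
      have "a ! k = a ! l \<or> b ! \<pi> k = b ! \<pi> l"
        using that(3,4) ab[OF that(1,2)] ab[OF that(2,1)] by auto
      then show ?thesis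
      proof
        assume "a ! k = a ! l"
        then show ?thesis
          using that disj by (simp add: nth_eq_iff_index_eq)
      next
        assume "b ! \<pi> k = b ! \<pi> l"
        then have "\<pi> k = \<pi> l"
          using lt[OF that(1)] lt[OF that(2)] disj by (simp add: nth_eq_iff_index_eq)
        then show ?thesis
          using permutes_inj[OF \<pi>] by (simp add: inj_eq)
      qed
    qed
    from cases[OF S(1)] cases[OF S(2)] show ?thesis
    proof (elim disjE exE bexE conjE)
      fix k l
      assume "k < ?n" "l < ?n" "S = {a ! k, b ! \<pi> k}" "S' = {a ! l, b ! \<pi> l}"
      then show ?thesis
        using eq[of k l] S by simp
    qed (use S ad in auto)
  qed
qed

context finite_network
begin

text \<open>
  For the edge sets of the minor, the nodes in \<open>c\<close> and the interior vertices are on the same footing: both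
  may lie in any component. So a linking with \<open>m = c @ ints\<close> is a grove whose partition arises from the
  displayed one by inserting \<open>c\<close>. From left to right, the number of edges and groundedness make the minor
  of the incidence matrix nonzero, which yields the forest and the separation of the parts. From
  right to left, the number of edges is \<open>card_spanning_forest\<close>.
\<close>

lemma linking_iff_grove:
  assumes len: "length a = length b"
    and dist: "distinct (a @ b @ (c @ ints) @ d)"
    and nodes: "set (a @ b @ c @ d) = nodes G" and ints: "set ints = verts G - nodes G"
    and \<pi>: "\<pi> permutes {..<length a}"
  shows "linking a b (c @ ints) d \<pi> F \<longleftrightarrow>
    F \<in> groves G \<and> node_partition G F \<in> insertions (displayed_partition a b d \<pi>) (set c)"
proof -
  let ?Q = "displayed_partition a b d \<pi>"
  define R where "R = {(u, w) \<in> connection G F. u \<in> nodes G \<and> w \<in> nodes G}"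
  have verts: "set (a @ b @ (c @ ints) @ d) = verts G"
    using nodes ints nodes_subset by auto
  have "distinct (a @ b @ d)"
    using dist by auto
  note Q = displayed_partition_parts[OF len this \<pi>]
  have N: "\<Union>?Q \<union> set c = nodes G"
    using Q(1) nodes by auto
  have disj: "\<Union>?Q \<inter> set c = {}"
    using Q(1) dist by auto
  have ne: "{} \<notin> ?Q"
    using Q(2) by blast
  have R: "equiv (nodes G) R"
    by (rule equivI) (auto simp: R_def refl_on_def sym_def trans_def
      intro: connection_sym connection_trans)
  have part: "node_partition G F \<in> insertions ?Q (set c) \<longleftrightarrow>
      (\<forall>S\<in>?Q. \<forall>x\<in>S. \<forall>y\<in>S. (x, y) \<in> R) \<and>
      (\<forall>S\<in>?Q. \<forall>S'\<in>?Q. \<forall>x\<in>S. \<forall>y\<in>S'. (x, y) \<in> R \<longrightarrow> S = S') \<and>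
      (\<forall>x\<in>nodes G. \<exists>S\<in>?Q. \<exists>s\<in>S. (x, s) \<in> R)"
    using quotient_in_insertions_iff[of ?Q "set c" R] R ne disj
    by (simp add: N node_partition_def R_def)
  have lab: "a ! k \<in> set a" "b ! \<pi> k \<in> set b" if "k < length a" for k
    using that permutes_in_image[OF \<pi>, of k] len by auto
  have sub: "set a \<union> set b \<union> set d \<subseteq> nodes G"
    using nodes by auto
  show ?thesis
  proof
    assume l: "linking a b (c @ ints) d \<pi> F"
    then have FE: "F \<subseteq> edges G" and card: "card F = length (a @ c @ ints)"
      and gr: "grounded F (set b \<union> set d)" "grounded F (set a \<union> set d)"
      and link: "\<And>k. k < length a \<Longrightarrow> (a ! k, b ! \<pi> k) \<in> connection G F"
      by (auto simp: linking_def)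
    have "finite F"
      using FE finite_edges by (rule finite_subset)
    then obtain fs where fs: "distinct fs" "set fs = F"
      using finite_distinct_list by blast
    have lfs: "length fs = length (a @ c @ ints)"
      using distinct_card[OF fs(1)] fs(2) card by simp
    have rootsb: "verts G - set (a @ c @ ints) = set b \<union> set d"
      unfolding verts[symmetric] using dist by auto
    have "Determinant.det (incidence_mat (a @ c @ ints) fs) *
        Determinant.det (incidence_mat (a @ c @ ints) fs) = 1"
    proof (rule det_incidence_mat_squared[OF fs(1) _ lfs])
      show "grounded (set fs) (verts G - set (a @ c @ ints))"
        using gr(1) unfolding rootsb fs(2) .
    qed (use FE fs dist verts in auto)
    then have nz: "Determinant.det (incidence_mat (a @ c @ ints) fs) \<noteq> 0"
      by auto
    have forest: "spanning_forest G F"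
      using spanning_forest_if_det_nonzero[OF fs(1) _ lfs nz] FE fs(2) by simp
    have sepb: "r = r'" if "r \<in> set b \<union> set d" "r' \<in> set b \<union> set d" "(r, r') \<in> connection G F" for r r'
      using roots_separated_if_det_nonzero[OF fs(1) _ lfs nz, of r r'] that rootsb FE fs(2) by blast
    have "T \<inter> nodes G \<noteq> {}" if T: "T \<in> verts G // connection G F" for T
    proof -
      obtain v where v: "v \<in> verts G" "T = connection G F `` {v}"
        using T by (rule quotientE)
      then obtain r where "r \<in> set b \<union> set d" "(v, r) \<in> connection G F"
        using gr(1) by (auto simp: grounded_def)
      then show ?thesis
        using v sub by blast
    qed
    then have grove: "F \<in> groves G"
      using forest by (simp add: groves_def)
    have together: "(x, y) \<in> R" if S: "S \<in> ?Q" "x \<in> S" "y \<in> S" for S x y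
    proof -
      have "x \<in> nodes G" "y \<in> nodes G"
        using S Q(1) sub by blast+
      moreover have "(x, y) \<in> connection G F"
        using S link connection_sym by (fastforce simp: displayed_partition_def)
      ultimately show ?thesis
        by (simp add: R_def)
    qed
    have apart: "S = S'" if S: "S \<in> ?Q" "S' \<in> ?Q" "x \<in> S" "y \<in> S'" "(x, y) \<in> R" for S S' x y
    proof -
      obtain r r' where r: "r \<in> S" "r \<in> set b \<union> set d" "r' \<in> S'" "r' \<in> set b \<union> set d"
        using Q(3)[OF S(1)] Q(3)[OF S(2)] by blast
      have "(r, x) \<in> connection G F" "(x, y) \<in> connection G F" "(y, r') \<in> connection G F"
        using together[OF S(1) r(1) S(3)] S(5) together[OF S(2) S(4) r(3)] by (simp_all add: R_def)
      then have "r = r'"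
        using sepb[OF r(2,4)] connection_trans by metis
      then show ?thesis
        using Q(4)[OF S(1,2) r(1)] r(3) by blast
    qed
    have "\<exists>S\<in>?Q. \<exists>s\<in>S. (x, s) \<in> R" if x: "x \<in> nodes G" for x
    proof -
      obtain r where r: "r \<in> set b \<union> set d" "(x, r) \<in> connection G F"
        using gr(1) x nodes_subset by (auto simp: grounded_def)
      then have "(x, r) \<in> R"
        using x sub by (auto simp: R_def)
      moreover obtain S where "S \<in> ?Q" "r \<in> S"
        using Q(1) r by blast
      ultimately show ?thesis
        by blast
    qed
    then show "F \<in> groves G \<and> node_partition G F \<in> insertions ?Q (set c)"
      unfolding part using grove by (intro conjI ballI impI) (simp_all add: together apart)
  next
    assume "F \<in> groves G \<and> node_partition G F \<in> insertions ?Q (set c)"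
    then have grove: "F \<in> groves G"
      and t: "\<forall>S\<in>?Q. \<forall>x\<in>S. \<forall>y\<in>S. (x, y) \<in> R"
      and s: "\<forall>S\<in>?Q. \<forall>S'\<in>?Q. \<forall>x\<in>S. \<forall>y\<in>S'. (x, y) \<in> R \<longrightarrow> S = S'"
      and covered: "\<forall>x\<in>nodes G. \<exists>S\<in>?Q. \<exists>s\<in>S. (x, s) \<in> R"
      unfolding part by simp_all
    have together: "(x, y) \<in> R" if "S \<in> ?Q" "x \<in> S" "y \<in> S" for S x y
      using t that by blast
    have apart: "S = S'" if "S \<in> ?Q" "S' \<in> ?Q" "x \<in> S" "y \<in> S'" "(x, y) \<in> R" for S S' x y
      using s that by blast
    have forest: "spanning_forest G F"
      using grove by (simp add: groves_def)
    then have FE: "F \<subseteq> edges G"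
      by (simp add: spanning_forest_def)
    have grounded: "grounded F X" if X: "\<And>S. S \<in> ?Q \<Longrightarrow> \<exists>r. S \<inter> X = {r}" for X
      unfolding grounded_def
    proof
      fix v
      assume "v \<in> verts G"
      then obtain w where w: "w \<in> nodes G" "(v, w) \<in> connection G F"
        using grove_connects_to_node[OF grove] by metis
      then obtain S s where S: "S \<in> ?Q" "s \<in> S" "(w, s) \<in> R"
        using covered by blast
      obtain r where "S \<inter> X = {r}"
        using X[OF S(1)] ..
      then have r: "r \<in> S" "r \<in> X"
        by auto
      have "(w, s) \<in> connection G F" "(s, r) \<in> connection G F"
        using S(3) together[OF S(1,2) r(1)] by (simp_all add: R_def)
      then have "(v, r) \<in> connection G F"
        using connection_trans[OF w(2)] connection_trans by metis
      then show "\<exists>r\<in>X. (v, r) \<in> connection G F"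
        using r by blast
    qed
    have gr: "grounded F (set b \<union> set d)" "grounded F (set a \<union> set d)"
      by (rule grounded, erule Q(3), rule grounded, erule Q(2))
    have link: "(a ! k, b ! \<pi> k) \<in> connection G F" if "k < length a" for k
    proof -
      have "{a ! k, b ! \<pi> k} \<in> ?Q"
        using that by (auto simp: displayed_partition_def)
      then show ?thesis
        using together[of _ "a ! k" "b ! \<pi> k"] by (auto simp: R_def)
    qed
    have rootsb: "verts G - set (a @ c @ ints) = set b \<union> set d"
      unfolding verts[symmetric] using dist by auto
    have "card F = card (set (a @ c @ ints))"
    proof (rule card_spanning_forest[OF forest])
      show "set (a @ c @ ints) \<subseteq> verts G"
        unfolding verts[symmetric] by auto
      show "grounded F (verts G - set (a @ c @ ints))"
        unfolding rootsb by (rule gr)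
      fix r r'
      assume r: "r \<in> verts G - set (a @ c @ ints)" "r' \<in> verts G - set (a @ c @ ints)"
        "(r, r') \<in> connection G F"
      then obtain S S' where S: "S \<in> ?Q" "r \<in> S" "S' \<in> ?Q" "r' \<in> S'"
        unfolding rootsb using Q(1) by blast
      have "(r, r') \<in> R"
        using r sub unfolding rootsb by (auto simp: R_def)
      then have "S = S'"
        using apart S by blast
      moreover obtain t where t: "S \<inter> (set b \<union> set d) = {t}"
        using Q(3)[OF S(1)] ..
      ultimately have "r \<in> {t}" "r' \<in> {t}"
        unfolding t[symmetric] using S r(1,2) unfolding rootsb by simp_all
      then show "r = r'"
        by simp
    qed
    also have "\<dots> = length (a @ c @ ints)"
      using dist by (intro distinct_card) auto
    finally show "linking a b (c @ ints) d \<pi> F"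
      using FE gr link by (simp add: linking_def)
  qed
qed

lemma Pr_partition_eq:
  assumes "groves G \<noteq> {}"
  shows "Pr_partition G P =
    (\<Sum>F | F \<in> groves G \<and> node_partition G F \<in> P. grove_weight G F) / (\<Sum>F\<in>groves G. grove_weight G F)"
proof -
  let ?A = "{F \<in> groves G. node_partition G F \<in> P}"
  have "groves G \<subseteq> Pow (edges G)"
    by (auto simp: groves_def spanning_forest_def)
  then have "?A \<subseteq> Pow (edges G)"
    by blast
  then have fin: "finite ?A"
    by (rule finite_subset) (simp add: finite_edges)
  have "Pr_partition G P = measure_pmf.prob (random_grove G) ?A"
    unfolding Pr_partition_def by (rule measure_prob_cong_0) (auto simp: pmf_random_grove[OF assms])
  also have "\<dots> = (\<Sum>F\<in>?A. grove_weight G F / (\<Sum>F\<in>groves G. grove_weight G F))"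
    using fin by (simp add: measure_measure_pmf_finite pmf_random_grove[OF assms])
  finally show ?thesis
    by (simp add: sum_divide_distrib)
qed

end

section \<open>The determinant formula\<close>

text \<open>
  The two Laplacian minors of \<open>det_response_minor\<close> are evaluated by the matrix tree theorem: the numerator
  with the lists \<open>a\<close>, \<open>b\<close>, \<open>d\<close>, and the interior minor with \<open>a = b = []\<close> and all nodes in place of \<open>d\<close>, for which
  the linkings are the uncrossing groves. The signs \<open>(-1) ^ (length c + length ints)\<close> and
  \<open>(-1) ^ length ints\<close> leave \<open>(-1) ^ card C\<close>.
\<close>

theorem theorem8p1:
  fixes G :: "('v, 'e) network" and A B C D :: "'v set" and a b c d :: "'v list"
  assumes "finite_network G"
    and "groves G \<noteq> {}"
    and "A \<inter> B = {}" "A \<inter> C = {}" "A \<inter> D = {}" "B \<inter> C = {}" "B \<inter> D = {}" "C \<inter> D = {}"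
    and "A \<union> B \<union> C \<union> D = nodes G"
    and "card A = card B"
    and "distinct a" "set a = A"
    and "distinct b" "set b = B"
    and "distinct c" "set c = C"
    and "distinct d" "set d = D"
  shows "Determinant.det (submatrix_of (response_matrix G) (a @ c) (b @ c)) =
    (-1) ^ card C *
    ((\<Sum>\<pi> | \<pi> permutes {..<card A}.
        of_int (sign \<pi>) * Pr_partition G (insertions (displayed_partition a b d \<pi>) C))
      / Pr_uncrossing G)"
proof -
  interpret finite_network G
    by fact
  let ?L = "submatrix_of (response_matrix G) (a @ c) (b @ c)"
  let ?W = "\<lambda>P. \<Sum>F | F \<in> groves G \<and> node_partition G F \<in> P. grove_weight G F"
  let ?Z = "\<Sum>F\<in>groves G. grove_weight G F"
  let ?U = "{{{i} | i. i \<in> nodes G}}"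
  have len: "length a = length b" "length a = card A" "length c = card C"
    using assms by (metis distinct_card)+
  have nodes: "set (a @ b @ c @ d) = nodes G"
    using assms by auto
  obtain ints where ints: "distinct ints" "set ints = verts G - nodes G"
    using finite_distinct_list[of "verts G - nodes G"] finite_verts by auto
  have dist: "distinct (a @ b @ (c @ ints) @ d)"
    using assms ints nodes by auto
  have verts: "set (a @ b @ (c @ ints) @ d) = verts G"
    using nodes ints nodes_subset by auto
  have minor: "Determinant.det (submatrix_of laplacian ((a @ c) @ ints) ((b @ c) @ ints)) =
      (-1) ^ length (c @ ints) * (\<Sum>\<pi> | \<pi> permutes {..<length a}.
        of_int (sign \<pi>) * ?W (insertions (displayed_partition a b d \<pi>) C))"
    using all_minors_matrix_tree[OF len(1) dist verts] linking_iff_grove[OF len(1) dist nodes ints(2)]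
      \<open>set c = C\<close> by simp
  have disp: "insertions (displayed_partition [] [] (a @ b @ c @ d) id) {} = ?U"
    unfolding nodes[symmetric] by (auto simp: insertions_def displayed_partition_def)
  have dist0: "distinct ([] @ [] @ ([] @ ints) @ a @ b @ c @ d)"
    "set ([] @ [] @ ([] @ ints) @ a @ b @ c @ d) = verts G"
    using dist verts by auto
  have interior: "Determinant.det (submatrix_of laplacian ints ints) = (-1) ^ length ints * ?W ?U"
  proof -
    have "linking [] [] ints (a @ b @ c @ d) id F \<longleftrightarrow> F \<in> groves G \<and> node_partition G F \<in> ?U" for F
      using linking_iff_grove[OF _ dist0(1) _ ints(2), of id F] nodes by (simp add: disp)
    then have "(\<Sum>F | linking [] [] ints (a @ b @ c @ d) id F. grove_weight G F) = ?W ?U"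
      by (intro sum.cong) auto
    then show ?thesis
      using all_minors_matrix_tree[OF _ dist0] by simp
  qed
  have nz: "Determinant.det (submatrix_of laplacian ints ints) \<noteq> 0"
    by (rule det_interior_laplacian_nonzero) fact+
  have "length (a @ c) = length (b @ c)" "set (a @ c) \<subseteq> nodes G" "set (b @ c) \<subseteq> nodes G"
    using len(1) nodes by auto
  from det_response_minor[OF \<open>groves G \<noteq> {}\<close> ints this]
  have "(-1) ^ length (c @ ints) * (\<Sum>\<pi> | \<pi> permutes {..<length a}.
        of_int (sign \<pi>) * ?W (insertions (displayed_partition a b d \<pi>) C)) =
      Determinant.det ?L * ((-1) ^ length ints * ?W ?U)"
    unfolding minor interior .
  moreover have "?W ?U \<noteq> 0"
    using nz unfolding interior by auto
  ultimately have L: "Determinant.det ?L = (-1) ^ length c * ((\<Sum>\<pi> | \<pi> permutes {..<length a}.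
        of_int (sign \<pi>) * ?W (insertions (displayed_partition a b d \<pi>) C)) / ?W ?U)"
    by (simp add: field_simps power_add)
  have "?Z \<noteq> 0"
  proof -
    have "0 < grove_weight G F" if "F \<in> groves G" for F
      using that conductance_pos unfolding grove_weight_def groves_def spanning_forest_def
      by (intro prod_pos) auto
    moreover have "groves G \<subseteq> Pow (edges G)"
      by (auto simp: groves_def spanning_forest_def)
    ultimately have "0 < ?Z"
      using finite_edges assms(2) by (intro sum_pos) (auto intro: finite_subset)
    then show ?thesis
      by simp
  qed
  then show ?thesis
    unfolding L Pr_uncrossing_def Pr_partition_eq[OF assms(2)] len(2)[symmetric] len(3)[symmetric]
    by (simp flip: sum_divide_distrib)
qed

end
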